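(* Assume that $\xi\in\mathbb{R}^n$ is reachable at time $N+1$ from the initial value $x_0\in\mathbb{R}^n$ for the system $x(k+1)=A(k)x(k)+B(k)u(k)$, $k=0,\dots,N$. Collect $l\ge \frac12(2n+m)(2n+m+1)$ data samples $(x^i(k),u^i(k),\lambda^i(k))\in\mathbb{R}^n\times\mathbb{R}^m\times\mathbb{R}^n$, $i=1,2,\dots,l$, for $k=0,1,\dots,N$, which are Gaussian with arbitrary mean and arbitrary positive-definite covariances. Then: (i) the optimal solution of the least-squares problem $\arg\min_{\nu(k)}\|\Upsilon(k)\nu(k)-\gamma(k)\|^2=[\Upsilon'(k)\Upsilon(k)]^{-1}\Upsilon'(k)\gamma(k)$ described in the context exists; (ii) the controller $u(k)=K(k)x(k)+K_1(k)\lambda^*$, $k=0,\dots,N$, obtained in the Q-learning algorithm described in the context is the optimal solution to the Problem stated in the context.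
   Context: Notation: $'$ denotes transpose, $\dagger$ the Moore–Penrose pseudoinverse. Let $A(k)\in\mathbb{R}^{n\times n}$, $B(k)\in\mathbb{R}^{n\times m}$ for $k=0,\dots,N$; let $Q,H\in\mathbb{R}^{n\times n}$ be symmetric positive semi-definite and $R\in\mathbb{R}^{m\times m}$ symmetric positive definite; $\xi\in\mathbb{R}^n$ is a given constant vector. Problem: for the system $x(k+1)=A(k)x(k)+B(k)u(k)$, $k=0,\dots,N$, $x(0)=x_0$, with unknown matrices $A(k),B(k)$, find the controller $u(k)$ which minimizes $J=\sum_{k=0}^N[x'(k)Qx(k)+u'(k)Ru(k)]+x'(N+1)Hx(N+1)$ and ensures that the terminal state satisfies $x(N+1)=\xi$. Reachability: $\xi$ is reachable at time $N+1$ from $x_0$ if there is a control sequence $u(0),\dots,u(N)$ such that $x(0)=x_0$ and $x(N+1)=\xi$. Q-learning algorithm (uses only the data, and $Q,R,H,x_0,\xi$; not $A(k),B(k)$). For each $k=0,\dots,N$ and $i=1,\dots,l$ the data are $x^i(k),u^i(k),\lambda^i(k)$ together with the measured successor state $x_+^i(k)=A(k)x^i(k)+B(k)u^i(k)$. Initialize $P(N+1)=H$, $\Phi(N+1,N)=I$, $G(N+1)=0$. For $k=N,N-1,\dots,0$ do: 1. Compute for $i=1,\dots,l$ $$\gamma^i(k)=[x^i(k)]'Qx^i(k)+[u^i(k)]'Ru^i(k)+[x_+^i(k)]'P(k+1)x_+^i(k)+2[x_+^i(k)]'\Phi'(k+1,N)\lambda^i(k)-[\lambda^i(k)]'G(k+1)\lambda^i(k),$$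 and set $\gamma(k)=[\gamma^1(k),\dots,\gamma^l(k)]'$. 2. With $z^i(k)=[x^i(k)',u^i(k)',\lambda^i(k)']'\in\mathbb{R}^{2n+m}$ having components $z^i_a(k)$, let $\Upsilon^i(k)$ be the column vector with entries $z_a^i(k)^2$ in the position $(a,a)$ and $2z_a^i(k)z_b^i(k)$ in the position $(a,b)$, $a<b$, the positions $(a,b)$ with $1\le a\le b\le 2n+m$ being ordered lexicographically. Let $\Upsilon(k)$ be the $l\times\frac12(2n+m)(2n+m+1)$ matrix whose $i$-th row is $\Upsilon^i(k)'$. 3. Solve the least-squares problem $\arg\min_{\nu(k)}\|\Upsilon(k)\nu(k)-\gamma(k)\|^2$ by $\nu(k)=[\Upsilon'(k)\Upsilon(k)]^{-1}\Upsilon'(k)\gamma(k)$, and let $\Lambda(k)$ be the symmetric $(2n+m)\times(2n+m)$ matrix whose upper triangular part, in the same ordering, is $\nu(k)$. Partition it conformally with $(x,u,\lambda)$ (block sizes $n,m,n$) as $$\Lambda(k)=\begin{bmatrix}\Lambda_{11}(k)&\Lambda_{21}'(k)&\Lambda_{31}'(k)\\ \Lambda_{21}(k)&\Lambda_{22}(k)&\Lambda_{32}'(k)\\ \Lambda_{31}(k)&\Lambda_{32}(k)&\Lambda_{33}(k)\end{bmatrix}.$$ 4. Set $K(k)=-\Lambda_{22}^{-1}(k)\Lambda_{21}(k)$, $K_1(k)=-\Lambda_{22}^{-1}(k)\Lambda_{32}'(k)$, $P(k)=\Lambda_{11}(k)-\Lambda_{21}'(k)\Lambda_{22}^{-1}(k)\Lambda_{21}(k)$,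 $\Phi(k,N)=\Lambda_{31}(k)-\Lambda_{32}(k)\Lambda_{22}^{-1}(k)\Lambda_{21}(k)$, $G(k)=G(k+1)+\Lambda_{32}(k)\Lambda_{22}^{-1}(k)\Lambda_{32}'(k)$. After the loop set $$\lambda^*=[-\Lambda_{33}(0)+\Lambda_{32}(0)\Lambda_{22}^{-1}(0)\Lambda_{32}'(0)]^{\dagger}\Big[[\Lambda_{31}(0)-\Lambda_{32}(0)\Lambda_{22}^{-1}(0)\Lambda_{21}(0)]x_0-\xi\Big],$$ and output the feedback controller $u(k)=K(k)x(k)+K_1(k)\lambda^*$, where $x(k)$ is the state of the system started at $x(0)=x_0$. *)

theory Defs
  imports "HOL-Probability.Probability"
begin

section \<open>Matrices\<close>

text \<open>The notation \<open>real^'d\<close> gives \<open>'d\<close> exactly the sort \<open>finite\<close>; these synonyms allow for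
  index types that are also ordered.  The row index comes first in \<open>rmat\<close>.\<close>

type_synonym 'd rvec = "(real, 'd) vec"
type_synonym ('r, 'c) rmat = "((real, 'c) vec, 'r) vec"

definition pos_semidef :: "real^'n^'n \<Rightarrow> bool" where
  "pos_semidef S \<longleftrightarrow> transpose S = S \<and> (\<forall>x. 0 \<le> x \<bullet> (S *v x))"

definition pos_def :: "real^'n^'n \<Rightarrow> bool" where
  "pos_def S \<longleftrightarrow> transpose S = S \<and> (\<forall>x. x \<noteq> 0 \<longrightarrow> 0 < x \<bullet> (S *v x))"

definition is_moore_penrose :: "real^'n^'m \<Rightarrow> real^'m^'n \<Rightarrow> bool" where
  "is_moore_penrose S X \<longleftrightarrow> S ** X ** S = S \<and> X ** S ** X = X \<and>
     transpose (S ** X) = S ** X \<and> transpose (X ** S) = X ** S"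

definition pseudo_inv :: "real^'n^'m \<Rightarrow> real^'m^'n" where
  "pseudo_inv S = (THE X. is_moore_penrose S X)"

section \<open>Non-degenerate Gaussian vectors\<close>

definition gaussian_density :: "real^'d \<Rightarrow> real^'d^'d \<Rightarrow> real^'d \<Rightarrow> real" where
  "gaussian_density \<mu> S x =
     exp (- ((x - \<mu>) \<bullet> (matrix_inv S *v (x - \<mu>))) / 2) / sqrt ((2 * pi) ^ CARD('d) * det S)"

text \<open>The covariance matrix \<open>S\<close> is required to be positive definite, so that the law of \<open>Z\<close>
  has the usual density.\<close>

definition gaussian_vector :: "'w measure \<Rightarrow> ('w \<Rightarrow> real^'d) \<Rightarrow> real^'d \<Rightarrow> real^'d^'d \<Rightarrow> bool" where
  "gaussian_vector M Z \<mu> S \<longleftrightarrow>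
     pos_def S \<and> distributed M lborel Z (\<lambda>x. ennreal (gaussian_density \<mu> S x))"

section \<open>The control problem\<close>

primrec trajectory ::
  "(nat \<Rightarrow> real^'n^'n) \<Rightarrow> (nat \<Rightarrow> real^'m^'n) \<Rightarrow> real^'n \<Rightarrow> (nat \<Rightarrow> real^'m) \<Rightarrow> nat \<Rightarrow> real^'n" where
  "trajectory A B x0 u 0 = x0"
| "trajectory A B x0 u (Suc k) = A k *v trajectory A B x0 u k + B k *v u k"

definition reachable ::
  "(nat \<Rightarrow> real^'n^'n) \<Rightarrow> (nat \<Rightarrow> real^'m^'n) \<Rightarrow> nat \<Rightarrow> real^'n \<Rightarrow> real^'n \<Rightarrow> bool" where
  "reachable A B N x0 \<xi> \<longleftrightarrow> (\<exists>u. trajectory A B x0 u (N + 1) = \<xi>)"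

definition cost ::
  "(nat \<Rightarrow> real^'n^'n) \<Rightarrow> (nat \<Rightarrow> real^'m^'n) \<Rightarrow> real^'n^'n \<Rightarrow> real^'m^'m \<Rightarrow> real^'n^'n \<Rightarrow>
   nat \<Rightarrow> real^'n \<Rightarrow> (nat \<Rightarrow> real^'m) \<Rightarrow> real" where
  "cost A B Q R H N x0 u =
     (let x = trajectory A B x0 u in
       (\<Sum>k=0..N. x k \<bullet> (Q *v x k) + u k \<bullet> (R *v u k)) + x (N + 1) \<bullet> (H *v x (N + 1)))"

definition optimal_control ::
  "(nat \<Rightarrow> real^'n^'n) \<Rightarrow> (nat \<Rightarrow> real^'m^'n) \<Rightarrow> real^'n^'n \<Rightarrow> real^'m^'m \<Rightarrow> real^'n^'n \<Rightarrow>
   nat \<Rightarrow> real^'n \<Rightarrow> real^'n \<Rightarrow> (nat \<Rightarrow> real^'m) \<Rightarrow> bool" where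
  "optimal_control A B Q R H N x0 \<xi> u \<longleftrightarrow>
     is_arg_min (cost A B Q R H N x0) (\<lambda>v. trajectory A B x0 v (N + 1) = \<xi>) u"

section \<open>Quadratic regression\<close>

text \<open>Summands are ordered as in a stacked vector: all left coordinates precede the right ones.\<close>

instantiation sum :: (linorder, linorder) linorder
begin

definition less_eq_sum :: "'a + 'b \<Rightarrow> 'a + 'b \<Rightarrow> bool" where
  "less_eq_sum p q = (case p of
      Inl a \<Rightarrow> (case q of Inl b \<Rightarrow> a \<le> b | Inr _ \<Rightarrow> True)
    | Inr a \<Rightarrow> (case q of Inl _ \<Rightarrow> False | Inr b \<Rightarrow> a \<le> b))"

definition less_sum :: "'a + 'b \<Rightarrow> 'a + 'b \<Rightarrow> bool" where
  "less_sum p q \<longleftrightarrow> p \<le> q \<and> \<not> q \<le> p"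

instance
  by standard (auto simp: less_eq_sum_def less_sum_def split: sum.splits)

end

text \<open>The upper triangular positions \<open>(a, b)\<close>, \<open>a \<le> b\<close>, of a square matrix indexed by \<open>'d\<close>.
  Vectors of the half-vectorised entries are indexed by the positions themselves, which is the
  lexicographic enumeration up to the renaming of coordinates.\<close>

typedef (overloaded) ('d::linorder) upper = "{(a, b). (a::'d) \<le> b}"
  by auto

instance upper :: ("{finite, linorder}") finite
proof
  have "finite (Rep_upper ` (UNIV :: 'a upper set))"
    by (rule finite_subset[OF subset_UNIV]) simp
  then show "finite (UNIV :: 'a upper set)"
    by (rule finite_imageD) (auto simp: inj_on_def Rep_upper_inject)
qed

lemma card_upper: "CARD('d::{finite, linorder} upper) = CARD('d) * (CARD('d) + 1) div 2"
proof -
  let ?U = "{(a, b). (a::'d) \<le> b}" and ?L = "{(a, b). (b::'d) \<le> a}"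
  have "card ?U = CARD('d upper)"
    by (rule type_definition.card[OF type_definition_upper, symmetric])
  moreover have "card ?L = card ?U"
    by (rule bij_betw_same_card[of prod.swap]) (auto intro!: bij_betwI[where g = prod.swap])
  moreover have "card (?U \<inter> ?L) = CARD('d)"
    by (rule bij_betw_same_card[of fst]) (auto intro!: bij_betwI[where g = "\<lambda>a. (a, a)"])
  moreover have "?U \<union> ?L = UNIV" by auto
  then have "card (?U \<union> ?L) = CARD('d) * CARD('d)"
    using card_cartesian_product[of "UNIV :: 'd set" "UNIV :: 'd set"] by simp
  ultimately have "2 * CARD('d upper) = CARD('d) * (CARD('d) + 1)"
    using card_Un_Int[of ?U ?L] by simp
  then show ?thesis by linarith
qed

definition quad_features :: "'d::{finite, linorder} rvec \<Rightarrow> 'd upper rvec" where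
  "quad_features z = (\<chi> p. case Rep_upper p of (a, b) \<Rightarrow>
     if a = b then (z $ a)\<^sup>2 else 2 * (z $ a) * (z $ b))"

definition sym_matrix :: "'d::{finite, linorder} upper rvec \<Rightarrow> ('d, 'd) rmat" where
  "sym_matrix \<nu> = (\<chi> a b. \<nu> $ Abs_upper (min a b, max a b))"

definition ls_formula :: "real^'p^'l \<Rightarrow> real^'l \<Rightarrow> real^'p" where
  "ls_formula Y g = (matrix_inv (transpose Y ** Y) ** transpose Y) *v g"

definition ls_solutions :: "real^'p^'l \<Rightarrow> real^'l \<Rightarrow> (real^'p) set" where
  "ls_solutions Y g = {\<nu>. is_arg_min (\<lambda>\<nu>. (norm (Y *v \<nu> - g))\<^sup>2) (\<lambda>_. True) \<nu>}"

section \<open>The Q-learning algorithm\<close>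

record ('n, 'm) sample =
  smp_x :: "'n rvec"
  smp_u :: "'m rvec"
  smp_lam :: "'n rvec"
  smp_next :: "'n rvec"

text \<open>Data are indexed by time and sample number.\<close>

type_synonym ('l, 'n, 'm) data = "nat \<Rightarrow> 'l \<Rightarrow> ('n, 'm) sample"

type_synonym ('n, 'm) coord = "'n + ('m + 'n)"
type_synonym ('n, 'm) qmat = "(('n, 'm) coord, ('n, 'm) coord) rmat"

definition stack :: "real^'n \<Rightarrow> real^'m \<Rightarrow> real^'n \<Rightarrow> real^('n, 'm) coord" where
  "stack x u lam = (\<chi> a. case a of
      Inl i \<Rightarrow> x $ i
    | Inr (Inl j) \<Rightarrow> u $ j
    | Inr (Inr i) \<Rightarrow> lam $ i)"

text \<open>\<open>blk r c L\<close> is the block of \<open>L\<close> with row coordinates \<open>range r\<close> and column coordinates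
  \<open>range c\<close>; the coordinates of the three components are \<open>cx\<close>, \<open>cu\<close> and \<open>cl\<close>.\<close>

definition blk :: "('a \<Rightarrow> 'd) \<Rightarrow> ('b \<Rightarrow> 'd) \<Rightarrow> real^'d^'d \<Rightarrow> real^'b^'a" where
  "blk r c L = (\<chi> i j. L $ r i $ c j)"

definition cx :: "'n \<Rightarrow> ('n, 'm) coord" where "cx = Inl"
definition cu :: "'m \<Rightarrow> ('n, 'm) coord" where "cu = Inr \<circ> Inl"
definition cl :: "'n \<Rightarrow> ('n, 'm) coord" where "cl = Inr \<circ> Inr"

definition L11 :: "('n::finite, 'm::finite) qmat \<Rightarrow> ('n, 'n) rmat" where "L11 = blk cx cx"
definition L21 :: "('n::finite, 'm::finite) qmat \<Rightarrow> ('m, 'n) rmat" where "L21 = blk cu cx"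
definition L22 :: "('n::finite, 'm::finite) qmat \<Rightarrow> ('m, 'm) rmat" where "L22 = blk cu cu"
definition L31 :: "('n::finite, 'm::finite) qmat \<Rightarrow> ('n, 'n) rmat" where "L31 = blk cl cx"
definition L32 :: "('n::finite, 'm::finite) qmat \<Rightarrow> ('n, 'm) rmat" where "L32 = blk cl cu"
definition L33 :: "('n::finite, 'm::finite) qmat \<Rightarrow> ('n, 'n) rmat" where "L33 = blk cl cl"

text \<open>The iterate \<open>(P k, \<Phi> (k, N), G k)\<close>.\<close>

type_synonym 'n iterate = "('n, 'n) rmat \<times> ('n, 'n) rmat \<times> ('n, 'n) rmat"

definition regressor ::
  "('l::finite \<Rightarrow> ('n::{finite, linorder}, 'm::{finite, linorder}) sample) \<Rightarrow>
   ('l, ('n, 'm) coord upper) rmat" where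
  "regressor D = (\<chi> i. quad_features (stack (smp_x (D i)) (smp_u (D i)) (smp_lam (D i))))"

definition target ::
  "real^'n^'n \<Rightarrow> real^'m^'m \<Rightarrow> 'n iterate \<Rightarrow> ('l \<Rightarrow> ('n, 'm) sample) \<Rightarrow> real^'l" where
  "target Q R s D = (case s of (P, \<Phi>, G) \<Rightarrow>
     (\<chi> i. let x = smp_x (D i); u = smp_u (D i); lam = smp_lam (D i); y = smp_next (D i) in
        x \<bullet> (Q *v x) + u \<bullet> (R *v u) + y \<bullet> (P *v y)
        + 2 * (y \<bullet> (transpose \<Phi> *v lam)) - lam \<bullet> (G *v lam)))"

definition learned_matrix ::
  "('n::{finite, linorder}, 'n) rmat \<Rightarrow> ('m::{finite, linorder}, 'm) rmat \<Rightarrow> 'n iterate \<Rightarrow>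
   ('l::finite \<Rightarrow> ('n, 'm) sample) \<Rightarrow> ('n, 'm) qmat" where
  "learned_matrix Q R s D = sym_matrix (ls_formula (regressor D) (target Q R s D))"

definition update :: "('n::finite, 'm::finite) qmat \<Rightarrow> 'n iterate \<Rightarrow> 'n iterate" where
  "update L s = (case s of (_, _, G) \<Rightarrow>
     (L11 L - transpose (L21 L) ** matrix_inv (L22 L) ** L21 L,
      L31 L - L32 L ** matrix_inv (L22 L) ** L21 L,
      G + L32 L ** matrix_inv (L22 L) ** transpose (L32 L)))"

text \<open>After \<open>j\<close> passes through the loop the iterate belongs to time
  \<open>N + 1 - j\<close>, and pass \<open>j + 1\<close> uses the data of time \<open>N - j\<close>.\<close>

primrec passes ::
  "('n::{finite, linorder}, 'n) rmat \<Rightarrow> ('m::{finite, linorder}, 'm) rmat \<Rightarrow> ('n, 'n) rmat \<Rightarrow>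
   nat \<Rightarrow> ('l::finite, 'n, 'm) data \<Rightarrow> nat \<Rightarrow> 'n iterate" where
  "passes Q R H N D 0 = (H, mat 1, 0)"
| "passes Q R H N D (Suc j) =
     update (learned_matrix Q R (passes Q R H N D j) (D (N - j))) (passes Q R H N D j)"

definition iterate_at ::
  "('n::{finite, linorder}, 'n) rmat \<Rightarrow> ('m::{finite, linorder}, 'm) rmat \<Rightarrow> ('n, 'n) rmat \<Rightarrow>
   nat \<Rightarrow> ('l::finite, 'n, 'm) data \<Rightarrow> nat \<Rightarrow> 'n iterate" where
  "iterate_at Q R H N D k = passes Q R H N D (N + 1 - k)"

definition q_target ::
  "('n::{finite, linorder}, 'n) rmat \<Rightarrow> ('m::{finite, linorder}, 'm) rmat \<Rightarrow> ('n, 'n) rmat \<Rightarrow>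
   nat \<Rightarrow> ('l::finite, 'n, 'm) data \<Rightarrow> nat \<Rightarrow> 'l rvec" where
  "q_target Q R H N D k = target Q R (iterate_at Q R H N D (k + 1)) (D k)"

definition q_matrix ::
  "('n::{finite, linorder}, 'n) rmat \<Rightarrow> ('m::{finite, linorder}, 'm) rmat \<Rightarrow> ('n, 'n) rmat \<Rightarrow>
   nat \<Rightarrow> ('l::finite, 'n, 'm) data \<Rightarrow> nat \<Rightarrow> ('n, 'm) qmat" where
  "q_matrix Q R H N D k = learned_matrix Q R (iterate_at Q R H N D (k + 1)) (D k)"

definition gain_K :: "('n::finite, 'm::finite) qmat \<Rightarrow> ('m, 'n) rmat" where
  "gain_K L = - (matrix_inv (L22 L) ** L21 L)"

definition gain_K1 :: "('n::finite, 'm::finite) qmat \<Rightarrow> ('m, 'n) rmat" where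
  "gain_K1 L = - (matrix_inv (L22 L) ** transpose (L32 L))"

definition lam_star ::
  "('n::finite, 'm::finite) qmat \<Rightarrow> 'n rvec \<Rightarrow> 'n rvec \<Rightarrow> 'n rvec" where
  "lam_star L x0 \<xi> =
     pseudo_inv (- L33 L + L32 L ** matrix_inv (L22 L) ** transpose (L32 L)) *v
       ((L31 L - L32 L ** matrix_inv (L22 L) ** L21 L) *v x0 - \<xi>)"

text \<open>The policy \<open>(k, x) \<mapsto> K k x + K1 k \<lambda>*\<close> returned by the algorithm.\<close>

definition q_policy ::
  "('n::{finite, linorder}, 'n) rmat \<Rightarrow> ('m::{finite, linorder}, 'm) rmat \<Rightarrow> ('n, 'n) rmat \<Rightarrow>
   nat \<Rightarrow> ('l::finite, 'n, 'm) data \<Rightarrow> 'n rvec \<Rightarrow> 'n rvec \<Rightarrow> nat \<Rightarrow> 'n rvec \<Rightarrow> 'm rvec" where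
  "q_policy Q R H N D x0 \<xi> k x =
     gain_K (q_matrix Q R H N D k) *v x
     + gain_K1 (q_matrix Q R H N D k) *v lam_star (q_matrix Q R H N D 0) x0 \<xi>"

primrec closed_loop ::
  "(nat \<Rightarrow> real^'n^'n) \<Rightarrow> (nat \<Rightarrow> real^'m^'n) \<Rightarrow> real^'n \<Rightarrow> (nat \<Rightarrow> real^'n \<Rightarrow> real^'m) \<Rightarrow>
   nat \<Rightarrow> real^'n" where
  "closed_loop A B x0 \<pi> 0 = x0"
| "closed_loop A B x0 \<pi> (Suc k) =
     A k *v closed_loop A B x0 \<pi> k + B k *v \<pi> k (closed_loop A B x0 \<pi> k)"

definition applied_control ::
  "(nat \<Rightarrow> real^'n^'n) \<Rightarrow> (nat \<Rightarrow> real^'m^'n) \<Rightarrow> real^'n \<Rightarrow> (nat \<Rightarrow> real^'n \<Rightarrow> real^'m) \<Rightarrow>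
   nat \<Rightarrow> real^'m" where
  "applied_control A B x0 \<pi> k = \<pi> k (closed_loop A B x0 \<pi> k)"

section \<open>Random data\<close>

definition measured_data ::
  "(nat \<Rightarrow> real^'n^'n) \<Rightarrow> (nat \<Rightarrow> real^'m^'n) \<Rightarrow> (nat \<Rightarrow> 'l \<Rightarrow> real^'n) \<Rightarrow>
   (nat \<Rightarrow> 'l \<Rightarrow> real^'m) \<Rightarrow> (nat \<Rightarrow> 'l \<Rightarrow> real^'n) \<Rightarrow> nat \<Rightarrow> 'l \<Rightarrow> ('n, 'm) sample" where
  "measured_data A B x u lam k i =
     \<lparr>smp_x = x k i, smp_u = u k i, smp_lam = lam k i, smp_next = A k *v x k i + B k *v u k i\<rparr>"

text \<open>The joint vector of all samples of one time step.  If it is Gaussian with positive definite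
  covariance, so is each sample; independent non-degenerate Gaussian samples are the case of a
  block diagonal covariance.\<close>

definition stack_samples ::
  "('l::finite \<Rightarrow> real^'n) \<Rightarrow> ('l \<Rightarrow> real^'m) \<Rightarrow> ('l \<Rightarrow> real^'n) \<Rightarrow> real^('l \<times> ('n, 'm) coord)" where
  "stack_samples x u lam = (\<chi> p. stack (x (fst p)) (u (fst p)) (lam (fst p)) $ snd p)"

end

theory Submission
  imports Defs
begin

text \<open>Two ideas carry the theorem: the algorithm, almost surely, identifies the model-based quantities
  exactly, and the model-based controller is optimal by completion of squares.

  \<^emph>\<open>Identification.\<close>  With \<open>y = A x + B u\<close> the measured quantity \<open>\<gamma>\<close> is a quadratic form in
  \<open>z = (x, u, \<lambda>)\<close>; let \<open>\<Lambda>\<close> be its matrix, here \<open>bellman_matrix\<close>.  A quadratic form is linear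
  in the upper triangle of its matrix (\<open>quad_features_inner\<close>), so \<open>\<gamma> = \<Upsilon> \<nu>\<close> holds without
  residual for the true \<open>\<nu>\<close>, and the least-squares formula returns exactly this \<open>\<nu>\<close> as soon as
  \<open>\<Upsilon>' \<Upsilon>\<close> is invertible.  Its determinant is a polynomial in the joint vector of all samples of one
  time step.  It is nonzero at a suitable choice of samples built from the unit vectors
  (\<open>full_rank_features_exist\<close>, which is where the lower bound on the number of samples enters).
  A polynomial that is nonzero somewhere is nonzero Lebesgue-almost everywhere
  (\<open>AE_polynomial_nonzero\<close>), hence almost surely under a Gaussian law with a density.

  \<^emph>\<open>Optimality.\<close>  Put \<open>V k \<lambda> x = x' P(k) x + 2 \<lambda>' \<Phi>(k, N) x - \<lambda>' G(k) \<lambda>\<close>.  The update of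
  \<open>P, \<Phi>, G\<close> is the Schur complement of the block \<open>\<Lambda>\<^sub>2\<^sub>2\<close>, that is, minimisation over \<open>u\<close>:
  \<open>x' Q x + u' R u + V (k + 1) \<lambda> (A x + B u) = V k \<lambda> x + e' \<Lambda>\<^sub>2\<^sub>2 e\<close> with
  \<open>e = u - K x - K\<^sub>1 \<lambda>\<close>.  Summed along a trajectory this telescopes (\<open>cost_identity\<close>): for every
  control that steers to \<open>\<xi>\<close> the cost is a constant that depends only on \<open>\<lambda>\<close>, plus the sum of the
  terms \<open>e' \<Lambda>\<^sub>2\<^sub>2 e\<close>.  Since \<open>\<Lambda>\<^sub>2\<^sub>2\<close> is positive definite, a feasible control with all
  \<open>e = 0\<close> is optimal, and it is the only one.  The feedback has \<open>e = 0\<close> for any multiplier, so only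
  feasibility is left.  Its terminal state is \<open>\<Phi>(0, N) x\<^sub>0 - G(0) \<lambda>\<close>
  (\<open>closed_loop_terminal\<close>), and the equation \<open>G(0) \<lambda> = \<Phi>(0, N) x\<^sub>0 - \<xi>\<close> is solvable because every
  \<open>w\<close> in the kernel of \<open>G(0)\<close> satisfies \<open>w' x(N + 1) = w' \<Phi>(0, N) x\<^sub>0\<close> for all controls
  (\<open>unreachable_directions\<close>) and \<open>\<xi>\<close> is reachable, so that the right-hand side is orthogonal to that
  kernel.  The pseudoinverse of the symmetric matrix \<open>G(0)\<close> then
  produces a solution.\<close>

section \<open>Symmetric matrices and their quadratic forms\<close>

text \<open>Transposes are kept explicit, so that \<open>inner_transpose_mult\<close> below can move them across inner
  products.\<close>

declare transpose_matrix_vector [simp del] vector_transpose_matrix [simp del]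

lemma inner_transpose_mult: "x \<bullet> (transpose S *v y) = (S *v x) \<bullet> y"
  for S :: "real^'a^'b"
  using dot_lmul_matrix[of y S x] by (simp add: transpose_matrix_vector inner_commute)

lemma inner_symmetric_mult:
  fixes S :: "real^'a^'a"
  assumes "transpose S = S"
  shows "x \<bullet> (S *v y) = y \<bullet> (S *v x)"
  using inner_transpose_mult[of x S y] assms by (simp add: inner_commute)

lemma symmetric_matrixI:
  fixes S :: "real^'a^'a"
  assumes "\<And>x y. x \<bullet> (S *v y) = y \<bullet> (S *v x)"
  shows "transpose S = S"
proof -
  have "transpose S *v y = S *v y" for y
  proof -
    have "x \<bullet> (transpose S *v y) = x \<bullet> (S *v y)" for x
      unfolding inner_transpose_mult using assms[of x y] by (metis inner_commute)
    then show ?thesis using vector_eq_ldot by blast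
  qed
  then show ?thesis by (simp add: matrix_eq)
qed

lemma uminus_matrix_vector_mult: "(- S) *v x = - (S *v x)"
  for S :: "real^'a^'b"
  using matrix_vector_mult_diff_rdistrib[of 0 S x] by simp

lemma matrix_vector_mult_uminus: "S *v (- x) = - (S *v x)"
  for S :: "real^'a^'b"
  using matrix_vector_mult_diff_distrib[of S 0 x] by simp

lemma matrix_add_rdistrib: "(S + T) ** C = S ** C + T ** C"
  for S T :: "real^'b^'a"
  by (simp add: vec_eq_iff matrix_matrix_mult_def distrib_right sum.distrib)

lemma matrix_diff_rdistrib: "(S - T) ** C = S ** C - T ** C"
  for S T :: "real^'b^'a"
  by (simp add: vec_eq_iff matrix_matrix_mult_def left_diff_distrib sum_subtractf)

lemma matrix_diff_ldistrib: "C ** (S - T) = C ** S - C ** T"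
  for S T :: "real^'b^'a"
  by (simp add: vec_eq_iff matrix_matrix_mult_def right_diff_distrib sum_subtractf)

lemma invertible_if_kernel_trivial:
  fixes S :: "real^'a^'a"
  assumes "\<And>x. S *v x = 0 \<Longrightarrow> x = 0"
  shows "invertible S"
  using assms matrix_left_invertible_ker[of S] invertible_left_inverse[of S] by blast

lemma matrix_inv_inverse:
  fixes S :: "real^'a^'a"
  assumes "invertible S"
  shows "S ** matrix_inv S = mat 1" "matrix_inv S ** S = mat 1"
  using assms someI_ex[of "\<lambda>T. S ** T = mat 1 \<and> T ** S = mat 1"]
  unfolding invertible_def matrix_inv_def by blast+

lemma matrix_inv_cancel:
  fixes S :: "real^'a^'a"
  assumes "invertible S"
  shows "S *v (matrix_inv S *v x) = x" "matrix_inv S *v (S *v x) = x"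
  by (simp_all add: matrix_vector_mul_assoc matrix_inv_inverse[OF assms])

lemma symmetric_matrix_inv:
  fixes S :: "real^'a^'a"
  assumes S: "invertible S" "transpose S = S"
  shows "transpose (matrix_inv S) = matrix_inv S"
proof (rule symmetric_matrixI)
  fix x y
  have "x \<bullet> (matrix_inv S *v y) = (S *v (matrix_inv S *v x)) \<bullet> (matrix_inv S *v y)"
    by (simp add: matrix_inv_cancel S)
  also have "\<dots> = (matrix_inv S *v x) \<bullet> (S *v (matrix_inv S *v y))"
    using inner_symmetric_mult[OF S(2)] by (simp add: inner_commute)
  finally show "x \<bullet> (matrix_inv S *v y) = y \<bullet> (matrix_inv S *v x)"
    by (simp add: matrix_inv_cancel S inner_commute)
qed

lemma pos_def_invertible:
  assumes "pos_def S"
  shows "invertible S"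
proof (rule invertible_if_kernel_trivial)
  fix x assume "S *v x = 0"
  then show "x = 0" using assms by (force simp: pos_def_def)
qed

lemma pos_def_inverse_form:
  assumes "pos_def S"
  shows "0 \<le> y \<bullet> (matrix_inv S *v y)" and "y \<bullet> (matrix_inv S *v y) = 0 \<Longrightarrow> y = 0"
proof -
  note inv = matrix_inv_cancel[OF pos_def_invertible[OF assms]]
  let ?z = "matrix_inv S *v y"
  have eq: "y \<bullet> ?z = ?z \<bullet> (S *v ?z)" by (simp add: inv inner_commute)
  show "0 \<le> y \<bullet> ?z"
    using assms unfolding eq pos_def_def by (cases "?z = 0") (auto intro: less_imp_le)
  show "y = 0" if "y \<bullet> ?z = 0"
  proof -
    have "?z = 0" using that assms unfolding eq pos_def_def by force
    then show ?thesis using inv(1)[of y] by simp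
  qed
qed

section \<open>The pseudoinverse of a symmetric matrix\<close>

lemma moore_penrose_unique:
  assumes X: "is_moore_penrose S X" and Y: "is_moore_penrose S Y"
  shows "X = Y"
proof -
  note x = X[unfolded is_moore_penrose_def] and y = Y[unfolded is_moore_penrose_def]
  have "S ** X = transpose (S ** X)" using x by simp
  also have "\<dots> = transpose (S ** Y ** S ** X)" using y by simp
  also have "\<dots> = transpose (S ** X) ** transpose (S ** Y)"
    by (simp add: matrix_transpose_mul matrix_mul_assoc)
  also have "\<dots> = S ** Y" using x y by (simp add: matrix_mul_assoc)
  finally have SX: "S ** X = S ** Y" .
  have "X ** S = transpose (X ** S)" using x by simp
  also have "\<dots> = transpose (X ** (S ** Y ** S))" using y by simp
  also have "\<dots> = transpose (Y ** S) ** transpose (X ** S)"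
    by (simp add: matrix_transpose_mul matrix_mul_assoc)
  also have "\<dots> = (Y ** S) ** (X ** S)" using x y by simp
  also have "\<dots> = Y ** (S ** X ** S)" by (simp add: matrix_mul_assoc)
  finally have XS: "X ** S = Y ** S" using x by simp
  have "X = X ** S ** X" using x by simp
  also have "\<dots> = Y ** (S ** Y)" by (simp only: XS SX matrix_mul_assoc[symmetric])
  also have "\<dots> = Y" using y by (simp add: matrix_mul_assoc)
  finally show ?thesis .
qed

text \<open>The projection is the sum of the rank-one projections of an orthonormal basis.\<close>

lemma orthogonal_projection_matrix_exists:
  fixes V :: "(real^'a) set"
  assumes "subspace V"
  obtains T :: "real^'a^'a" where "transpose T = T"
    and "\<And>x. T *v x \<in> V" and "\<And>x. x \<in> V \<Longrightarrow> T *v x = x"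
proof -
  obtain E where E: "E \<subseteq> V" "pairwise orthogonal E" "\<And>b. b \<in> E \<Longrightarrow> norm b = 1"
    "independent E" "span E = V"
    using orthonormal_basis_subspace[OF assms] by metis
  have fin: "finite E" using E(4) by (rule independent_imp_finite)
  define f where "f x = (\<Sum>b\<in>E. (x \<bullet> b) *\<^sub>R b)" for x
  have lin: "linear f"
    unfolding f_def
    by (rule linearI) (simp_all add: inner_add_left scaleR_left_distrib sum.distrib scaleR_sum_right)
  have fV: "f x \<in> V" for x
    unfolding f_def using E(1) assms by (auto intro!: subspace_sum subspace_mul)
  have fE: "f x = x" if "x \<in> E" for x
  proof -
    have "f x = (\<Sum>b\<in>E. if b = x then x else 0)"
      unfolding f_def
    proof (rule sum.cong[OF refl])
      fix b assume b: "b \<in> E"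
      show "(x \<bullet> b) *\<^sub>R b = (if b = x then x else 0)"
        using E(2) E(3)[OF b] b that
        by (auto simp: pairwise_def orthogonal_def dot_square_norm)
    qed
    then show ?thesis using fin that by simp
  qed
  have fid: "f x = x" if "x \<in> V" for x
    using that linear_eq_on_span[OF lin linear_ident] fE unfolding E(5)[symmetric] by blast
  have sym: "x \<bullet> f y = y \<bullet> f x" for x y
    unfolding f_def by (simp add: inner_sum_right mult.commute)
  show thesis
  proof (rule that[of "matrix f"])
    have [simp]: "matrix f *v x = f x" for x using lin by (simp add: matrix_works)
    show "transpose (matrix f) = matrix f" by (rule symmetric_matrixI) (simp add: sym)
    show "matrix f *v x \<in> V" for x by (simp add: fV)
    show "matrix f *v x = x" if "x \<in> V" for x by (simp add: fid that)
  qed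
qed

text \<open>Adding to \<open>S\<close> the orthogonal projection \<open>T\<close> onto its kernel makes it invertible; since \<open>S\<close> and
  \<open>T\<close> annihilate each other, subtracting \<open>T\<close> again from the inverse leaves the pseudoinverse.\<close>

lemma moore_penrose_exists:
  fixes S :: "real^'a^'a"
  assumes S: "transpose S = S"
  shows "\<exists>X. is_moore_penrose S X"
proof -
  have "subspace {x. S *v x = 0}"
    by (rule subspaceI) (simp_all add: matrix_vector_right_distrib matrix_vector_mult_scaleR)
  then obtain T :: "real^'a^'a" where T: "transpose T = T" "\<And>x. S *v (T *v x) = 0"
    "\<And>x. S *v x = 0 \<Longrightarrow> T *v x = x"
    using orthogonal_projection_matrix_exists[of "{x. S *v x = 0}"] by auto
  have ST: "S ** T = 0" using T(2) by (simp add: matrix_eq matrix_vector_mul_assoc[symmetric])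
  have TS: "T ** S = 0"
    using arg_cong[OF ST, of transpose] by (simp add: matrix_transpose_mul S T(1))
      (simp add: transpose_def vec_eq_iff)
  have TT: "T ** T = T" using T(2,3) by (simp add: matrix_eq matrix_vector_mul_assoc[symmetric])
  have inv: "invertible (S + T)"
  proof (rule invertible_if_kernel_trivial)
    fix x assume x: "(S + T) *v x = 0"
    have "T *v x = T *v (T *v x)" by (simp add: matrix_vector_mul_assoc TT)
    also have "\<dots> = T *v ((S + T) *v x)"
      by (simp add: matrix_vector_mult_add_rdistrib matrix_vector_right_distrib
          matrix_vector_mul_assoc TS)
    finally have Tx: "T *v x = 0" using x by simp
    then have "S *v x = 0" using x by (simp add: matrix_vector_mult_add_rdistrib)
    then show "x = 0" using T(3) Tx by metis
  qed
  let ?W = "matrix_inv (S + T)"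
  note W = matrix_inv_inverse[OF inv]
  have "?W ** T = ?W ** ((S + T) ** T)" by (simp add: matrix_add_rdistrib ST TT)
  then have WT: "?W ** T = T" by (simp add: matrix_mul_assoc W)
  have "T ** ?W = (T ** (S + T)) ** ?W" by (simp add: matrix_add_ldistrib TS TT)
  then have TW: "T ** ?W = T" by (simp add: matrix_mul_assoc[symmetric] W)
  \<comment> \<open>Both products are the orthogonal projection onto the range of \<open>S\<close>.\<close>
  have SX: "S ** (?W - T) = mat 1 - T"
  proof -
    have "S ** ?W + T ** ?W = mat 1" using W(1) by (simp add: matrix_add_rdistrib)
    then have "S ** ?W = mat 1 - T" by (simp add: TW eq_diff_eq)
    then show ?thesis by (simp add: matrix_diff_ldistrib ST)
  qed
  have XS: "(?W - T) ** S = mat 1 - T"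
  proof -
    have "?W ** S + ?W ** T = mat 1" using W(2) by (simp add: matrix_add_ldistrib)
    then have "?W ** S = mat 1 - T" by (simp add: WT eq_diff_eq)
    then show ?thesis by (simp add: matrix_diff_rdistrib TS)
  qed
  have "transpose (mat 1 - T) = mat 1 - T"
    using T(1) by (simp add: transpose_def vec_eq_iff mat_def)
  moreover have "(mat 1 - T) ** S = S" by (simp add: matrix_diff_rdistrib TS)
  moreover have "(mat 1 - T) ** (?W - T) = ?W - T"
    by (simp add: matrix_diff_rdistrib matrix_diff_ldistrib TW TT)
  ultimately have "is_moore_penrose S (?W - T)"
    unfolding is_moore_penrose_def SX XS by simp
  then show ?thesis ..
qed

text \<open>The hypothesis on \<open>b\<close> says that \<open>b\<close> is orthogonal to the kernel of \<open>S\<close>, which for symmetric \<open>S\<close> is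
  the orthogonal complement of its range.  The residual \<open>b - S S\<^sup>\<dagger> b\<close> lies in that kernel, and it is
  orthogonal both to \<open>b\<close> and to \<open>S S\<^sup>\<dagger> b\<close>, hence to itself.\<close>

lemma pseudo_inv_solves:
  fixes S :: "real^'a^'a"
  assumes S: "transpose S = S" and b: "\<And>w. S *v w = 0 \<Longrightarrow> w \<bullet> b = 0"
  shows "S *v (pseudo_inv S *v b) = b"
proof -
  have "\<exists>!X. is_moore_penrose S X"
    using moore_penrose_exists[OF S] moore_penrose_unique by blast
  then have "is_moore_penrose S (pseudo_inv S)" unfolding pseudo_inv_def by (rule theI')
  then have X: "S ** pseudo_inv S ** S = S" "transpose (S ** pseudo_inv S) = S ** pseudo_inv S"
    by (auto simp: is_moore_penrose_def)
  let ?F = "S ** pseudo_inv S"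
  let ?r = "b - ?F *v b"
  \<comment> \<open>The projection \<open>?F\<close> fixes the range of \<open>S\<close>; transposed, \<open>S\<close> absorbs \<open>?F\<close>.\<close>
  have "S ** ?F = transpose (?F ** S)" using X(2) S by (metis matrix_transpose_mul)
  then have SF: "S ** ?F = S" using X(1) S by simp
  have FF: "?F ** ?F = ?F" using X(1) by (simp add: matrix_mul_assoc)
  have "S *v ?r = 0"
    by (simp add: matrix_vector_mult_diff_distrib matrix_vector_mul_assoc SF)
  then have "?r \<bullet> b = 0" by (rule b)
  moreover have "?r \<bullet> (?F *v b) = 0"
  proof -
    have "?F *v ?r = 0"
      by (simp add: matrix_vector_mult_diff_distrib matrix_vector_mul_assoc FF)
    then show ?thesis
      using inner_symmetric_mult[OF X(2), of ?r b] by simp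
  qed
  ultimately have "?r \<bullet> ?r = 0" by (simp add: inner_diff_right)
  then have "?F *v b = b" by simp
  then show ?thesis by (simp add: matrix_vector_mul_assoc)
qed

section \<open>Zero sets of polynomials\<close>

text \<open>On every line through \<open>a\<close> the polynomial does not vanish identically, so it has finitely many zeros
  there.  By Fubini, for almost every \<open>t\<close> the map \<open>v \<mapsto> f (a + t v)\<close> is nonzero almost
  everywhere.  One such \<open>t \<noteq> 0\<close> suffices, since dilations about \<open>a\<close> preserve null sets.\<close>

lemma AE_polynomial_nonzero:
  fixes f :: "'a::euclidean_space \<Rightarrow> real"
  assumes f: "real_polynomial_function f" and a: "f a \<noteq> 0"
  shows "AE x in lborel. f x \<noteq> 0"
proof -
  have cont: "continuous_on UNIV f"
    using continuous_real_polymonial_function[OF f] by (simp add: continuous_on_eq_continuous_at)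
  have ray: "AE t in lborel. f (a + t *\<^sub>R v) \<noteq> 0" for v
  proof -
    have "polynomial_function (\<lambda>t::real. a + t *\<^sub>R v)"
      by (intro polynomial_function_add polynomial_function_const polynomial_function_bounded_linear
          bounded_linear_scaleR_left)
    from real_polynomial_function_compose[OF this f]
    obtain c n where c: "f (a + t *\<^sub>R v) = (\<Sum>i\<le>n. c i * t^i)" for t
      unfolding real_polynomial_function_iff_sum by (auto simp: fun_eq_iff)
    have "(\<Sum>i\<le>n. c i * 0^i) \<noteq> 0" using a c[of 0] by simp
    then have "finite {t. f (a + t *\<^sub>R v) = 0}"
      unfolding c polyfun_finite_roots
      by (metis (no_types, lifting) atMost_iff mult_eq_0_iff sum.neutral)
    then show ?thesis by (auto intro!: AE_I' finite_imp_null_set_lborel)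
  qed
  have meas: "(\<lambda>z::real \<times> 'a. f (a + fst z *\<^sub>R snd z)) \<in> borel_measurable (lborel \<Otimes>\<^sub>M lborel)"
  proof -
    have "continuous_on UNIV (\<lambda>z::real \<times> 'a. f (a + fst z *\<^sub>R snd z))"
      by (rule continuous_on_compose2[OF cont]) (auto intro!: continuous_intros)
    then have "(\<lambda>z::real \<times> 'a. f (a + fst z *\<^sub>R snd z)) \<in> borel_measurable borel"
      by (rule borel_measurable_continuous_onI)
    then show ?thesis by (simp add: lborel_prod)
  qed
  have "AE t in lborel. AE v in lborel. f (a + t *\<^sub>R v) \<noteq> 0"
  proof (subst lborel_pair.AE_commute)
    show "{z \<in> space (lborel \<Otimes>\<^sub>M lborel). f (a + fst z *\<^sub>R snd z) \<noteq> 0}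
        \<in> sets (lborel \<Otimes>\<^sub>M (lborel :: 'a measure))"
      using meas by measurable
    show "AE v in lborel. AE t in lborel. f (a + t *\<^sub>R v) \<noteq> 0" using ray by simp
  qed
  moreover have "AE t in lborel. t \<noteq> (0::real)"
    by (rule AE_I'[OF finite_imp_null_set_lborel[of "{0}"]]) auto
  ultimately have "AE t in lborel. t \<noteq> (0::real) \<and> (AE v in lborel. f (a + t *\<^sub>R v) \<noteq> 0)"
    by eventually_elim simp
  moreover have "ae_filter (lborel :: real measure) \<noteq> bot" by (simp add: ae_filter_eq_bot_iff)
  ultimately obtain t :: real where t: "t \<noteq> 0" "AE v in lborel. f (a + t *\<^sub>R v) \<noteq> 0"
    using eventually_happens by blast
  have dens: "AE x in density (distr lborel borel (\<lambda>v. a + t *\<^sub>R v)) (\<lambda>_. ennreal (\<bar>t\<bar>^DIM('a))). f x \<noteq> 0"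
  proof (subst AE_density)
    have "{x. f x \<noteq> 0} \<in> sets borel"
      using borel_measurable_continuous_onI[OF cont] by measurable
    then have "AE x in distr lborel borel (\<lambda>v. a + t *\<^sub>R v). f x \<noteq> 0"
      using t(2) by (subst AE_distr_iff) auto
    then show "AE x in distr lborel borel (\<lambda>v. a + t *\<^sub>R v).
        0 < ennreal (\<bar>t\<bar>^DIM('a)) \<longrightarrow> f x \<noteq> 0" by simp
  qed simp
  show ?thesis by (subst lborel_affine[OF t(1), of a]) (rule dens)
qed

lemma real_polynomial_function_det:
  assumes "\<And>i j. real_polynomial_function (\<lambda>x. F x $ i $ j)"
  shows "real_polynomial_function (\<lambda>x. det (F x :: real^'a^'a))"
  unfolding det_def using assms
  by (intro real_polynomial_function_sum real_polynomial_function_prod real_polynomial_function.intros(4)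
      real_polynomial_function.intros(2)) (auto simp: finite_permutations)

text \<open>The law of \<open>Z\<close> has a density, so Lebesgue null sets have probability zero.\<close>

lemma AE_gaussian_vector:
  assumes "gaussian_vector M Z \<mu> S" and "AE z in lborel. P z"
  shows "AE \<omega> in M. P (Z \<omega>)"
proof -
  have d: "distributed M lborel Z (\<lambda>x. ennreal (gaussian_density \<mu> S x))"
    using assms(1) by (simp add: gaussian_vector_def)
  have "AE z in distr M lborel Z. P z"
    unfolding distributed_distr_eq_density[OF d]
    by (subst AE_density[OF distributed_borel_measurable[OF d]]) (use assms(2) in auto)
  then show ?thesis by (rule AE_distrD[OF distributed_measurable[OF d]])
qed

section \<open>Quadratic regression\<close>

lemma gram_invertible:
  fixes Y :: "real^'p^'l"
  assumes "\<And>v. Y *v v = 0 \<Longrightarrow> v = 0"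
  shows "invertible (transpose Y ** Y)"
proof (rule invertible_if_kernel_trivial)
  fix v assume "(transpose Y ** Y) *v v = 0"
  then have "v \<bullet> (transpose Y *v (Y *v v)) = 0" by (simp add: matrix_vector_mul_assoc)
  then show "v = 0" using assms by (simp add: inner_transpose_mult)
qed

text \<open>By the normal equations the residual of the formula is orthogonal to the range of \<open>Y\<close>; Pythagoras
  then splits the squared error, and the second summand vanishes at one point only.\<close>

lemma ls_solutions_eq:
  fixes Y :: "real^'p^'l"
  assumes inv: "invertible (transpose Y ** Y)"
  shows "ls_solutions Y g = {ls_formula Y g}"
proof -
  let ?n = "ls_formula Y g"
  have normal: "transpose Y *v (Y *v ?n - g) = 0"
  proof -
    have "(transpose Y ** Y) *v ?n = transpose Y *v g"
      unfolding ls_formula_def matrix_vector_mul_assoc[symmetric, of "matrix_inv _"]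
      by (simp add: matrix_inv_cancel[OF inv])
    then show ?thesis by (simp add: matrix_vector_mult_diff_distrib matrix_vector_mul_assoc)
  qed
  have pyth: "(norm (Y *v v - g))\<^sup>2 = (norm (Y *v ?n - g))\<^sup>2 + (norm (Y *v (v - ?n)))\<^sup>2" for v
  proof -
    have "(Y *v (v - ?n)) \<bullet> (Y *v ?n - g) = 0"
      using inner_transpose_mult[of "v - ?n" Y "Y *v ?n - g"] normal by simp
    moreover have split: "Y *v v - g = (Y *v ?n - g) + Y *v (v - ?n)"
      by (simp add: matrix_vector_mult_diff_distrib)
    ultimately show ?thesis
      unfolding split power2_norm_eq_inner by (simp add: inner_add_left inner_add_right inner_commute)
  qed
  have ker: "v = ?n" if "Y *v (v - ?n) = 0" for v
  proof -
    have "(transpose Y ** Y) *v (v - ?n) = 0"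
      using that by (simp add: matrix_vector_mul_assoc[symmetric])
    then show ?thesis using matrix_inv_cancel(2)[OF inv, of "v - ?n"] by simp
  qed
  have "v \<in> ls_solutions Y g \<longleftrightarrow> v = ?n" for v
  proof
    assume "v \<in> ls_solutions Y g"
    then have "(norm (Y *v v - g))\<^sup>2 \<le> (norm (Y *v ?n - g))\<^sup>2"
      by (simp add: ls_solutions_def is_arg_min_linorder)
    then have "Y *v (v - ?n) = 0" unfolding pyth[of v] by simp
    then show "v = ?n" by (rule ker)
  next
    assume "v = ?n"
    moreover have "(norm (Y *v ?n - g))\<^sup>2 \<le> (norm (Y *v w - g))\<^sup>2" for w
      unfolding pyth[of w] by simp
    ultimately show "v \<in> ls_solutions Y g" by (simp add: ls_solutions_def is_arg_min_linorder)
  qed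
  then show ?thesis by blast
qed

lemma ls_formula_exact:
  fixes Y :: "real^'p^'l"
  assumes "invertible (transpose Y ** Y)"
  shows "ls_formula Y (Y *v \<nu>) = \<nu>"
  unfolding ls_formula_def
  by (simp add: matrix_vector_mul_assoc[symmetric, of _ "transpose Y"] matrix_vector_mul_assoc[of "transpose Y"]
      matrix_inv_cancel[OF assms])

definition half_vec :: "('d::{finite, linorder}, 'd) rmat \<Rightarrow> 'd upper rvec" where
  "half_vec L = (\<chi> p. L $ fst (Rep_upper p) $ snd (Rep_upper p))"

lemma sym_matrix_half_vec:
  assumes "transpose L = L"
  shows "sym_matrix (half_vec L) = L"
proof -
  have sym: "L $ a $ b = L $ b $ a" for a b
    using arg_cong[OF assms, of "\<lambda>T. T $ b $ a"] by (simp add: transpose_def)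
  show ?thesis
    by (simp add: vec_eq_iff sym_matrix_def half_vec_def Abs_upper_inverse min_def max_def)
      (metis sym)
qed

lemma sum_upper:
  "(\<Sum>p\<in>UNIV. F (Rep_upper (p :: 'd::{finite, linorder} upper))) = (\<Sum>q | fst q \<le> snd q. F q)"
proof -
  have "bij_betw (Rep_upper :: 'd upper \<Rightarrow> _) UNIV {q. fst q \<le> snd q}"
    using type_definition.Rep_range[OF type_definition_upper]
    by (auto simp: bij_betw_def inj_on_def Rep_upper_inject)
  then show ?thesis by (rule sum.reindex_bij_betw)
qed

text \<open>The factor 2 in the features accounts for the two equal off-diagonal terms of the quadratic form.\<close>

lemma quad_features_inner: "quad_features z \<bullet> \<nu> = z \<bullet> (sym_matrix \<nu> *v z)"
  for z :: "'d::{finite, linorder} rvec"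
proof -
  define h where "h q = z $ fst q * z $ snd q * sym_matrix \<nu> $ fst q $ snd q" for q :: "'d \<times> 'd"
  have swap: "h (prod.swap q) = h q" for q
    by (simp add: h_def sym_matrix_def min.commute max.commute)
  have "quad_features z \<bullet> \<nu> = (\<Sum>p\<in>UNIV. (\<lambda>q. if fst q = snd q then h q else 2 * h q) (Rep_upper p))"
    unfolding inner_vec_def
  proof (rule sum.cong[OF refl])
    fix p :: "'d upper"
    obtain a b where ab: "Rep_upper p = (a, b)" by force
    with Rep_upper[of p] have "a \<le> b" by simp
    moreover have "Abs_upper (a, b) = p" using Rep_upper_inverse[of p] ab by simp
    ultimately show "quad_features z $ p \<bullet> \<nu> $ p =
        (\<lambda>q. if fst q = snd q then h q else 2 * h q) (Rep_upper p)"
      by (auto simp add: quad_features_def ab h_def sym_matrix_def power2_eq_square min_def max_def)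
  qed
  also have "\<dots> = (\<Sum>q | fst q \<le> snd q. if fst q = snd q then h q else 2 * h q)"
    by (rule sum_upper)
  also have "\<dots> = (\<Sum>q | fst q \<le> snd q. h q + (if fst q < snd q then h q else 0))"
    by (rule sum.cong) auto
  also have "\<dots> = (\<Sum>q | fst q \<le> snd q. h q) + (\<Sum>q | fst q < snd q. h q)"
  proof -
    have "{q \<in> {q. fst q \<le> snd q}. fst q < snd q} = {q :: 'd \<times> 'd. fst q < snd q}" by auto
    then show ?thesis by (simp add: sum.distrib sum.inter_filter[symmetric])
  qed
  also have "(\<Sum>q | fst q < snd q. h q) = (\<Sum>q | snd q < fst q. h q)"
    by (rule sum.reindex_bij_witness[of _ prod.swap prod.swap]) (auto simp: swap)
  also have "(\<Sum>q | fst q \<le> snd q. h q) + \<dots> = (\<Sum>q\<in>UNIV. h q)"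
    by (subst sum.union_disjoint[symmetric]) (auto intro!: sum.cong)
  also have "\<dots> = (\<Sum>a\<in>UNIV. \<Sum>b\<in>UNIV. h (a, b))"
    by (simp add: sum.cartesian_product)
  also have "\<dots> = z \<bullet> (sym_matrix \<nu> *v z)"
    by (simp add: h_def inner_vec_def matrix_vector_mult_def sum_distrib_left mult_ac)
  finally show ?thesis .
qed

text \<open>The regressor for arbitrary sample vectors, without the record of a state transition.\<close>

definition feature_matrix :: "('l::finite \<Rightarrow> 'd::{finite, linorder} rvec) \<Rightarrow> ('l, 'd upper) rmat" where
  "feature_matrix z = (\<chi> i. quad_features (z i))"

lemma feature_matrix_mult: "(feature_matrix z *v \<nu>) $ i = z i \<bullet> (sym_matrix \<nu> *v z i)"
  by (simp add: feature_matrix_def matrix_vector_mul_component quad_features_inner)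

text \<open>The samples \<open>e\<^sub>a\<close> and \<open>e\<^sub>a + e\<^sub>b\<close> for \<open>a < b\<close> determine a quadratic form: the former give its
  diagonal, the latter its off-diagonal entries by polarisation.  Each position of the upper triangle
  needs one sample; the remaining samples repeat these.\<close>

lemma full_rank_features_exist:
  assumes "CARD('d::{finite, linorder} upper) \<le> CARD('l::finite)"
  shows "\<exists>z :: 'l \<Rightarrow> 'd rvec. \<forall>\<nu>. feature_matrix z *v \<nu> = 0 \<longrightarrow> \<nu> = 0"
proof -
  obtain e :: "'d upper \<Rightarrow> 'l" where e: "inj e"
    using assms inj_on_iff_card_le[of "UNIV :: 'd upper set" "UNIV :: 'l set"] by auto
  define t :: "'d \<times> 'd \<Rightarrow> 'd rvec" where
    "t q = (if fst q = snd q then axis (fst q) 1 else axis (fst q) 1 + axis (snd q) 1)" for q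
  \<comment> \<open>\<open>inv e\<close> maps the samples onto the positions, as there are at least as many samples.\<close>
  define z where "z i = t (Rep_upper (inv e i))" for i
  have "\<nu> = 0" if 0: "feature_matrix z *v \<nu> = 0" for \<nu>
  proof -
    let ?S = "sym_matrix \<nu>"
    have form: "t (a, b) \<bullet> (?S *v t (a, b)) = 0" if "a \<le> b" for a b
    proof -
      have "Rep_upper (inv e (e (Abs_upper (a, b)))) = (a, b)"
        using that by (simp add: inv_f_f[OF e] Abs_upper_inverse)
      then show ?thesis
        using feature_matrix_mult[of z \<nu> "e (Abs_upper (a, b))"] 0 by (simp add: z_def)
    qed
    have ax: "axis a 1 \<bullet> (?S *v axis b 1) = ?S $ a $ b" for a b
      by (simp add: inner_axis' matrix_vector_mul_component inner_axis)
    have diag: "?S $ a $ a = 0" for a using form[of a a] ax by (simp add: t_def)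
    have sym: "?S $ b $ a = ?S $ a $ b" for a b
      by (simp add: sym_matrix_def min.commute max.commute)
    have upper: "?S $ a $ b = 0" if "a \<le> b" for a b
    proof (cases "a = b")
      case False
      then show ?thesis
        using form[OF that] diag sym[of a b]
        by (simp add: t_def matrix_vector_right_distrib inner_add_left inner_add_right ax)
    qed (simp add: diag)
    have "\<nu> $ p = 0" for p
    proof -
      obtain a b where ab: "Rep_upper p = (a, b)" by force
      with Rep_upper[of p] have le: "a \<le> b" by simp
      have "Abs_upper (a, b) = p" using Rep_upper_inverse[of p] ab by simp
      then show ?thesis using upper[OF le] le by (simp add: sym_matrix_def min_def max_def)
    qed
    then show ?thesis by (simp add: vec_eq_iff)
  qed
  then show ?thesis by blast
qed

lemma AE_feature_gram_invertible:
  assumes "CARD('d::{finite, linorder} upper) \<le> CARD('l::finite)"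
  shows "AE w :: ('l \<times> 'd) rvec in lborel.
    (let Y = feature_matrix (\<lambda>i. \<chi> a. w $ (i, a)) in invertible (transpose Y ** Y))"
proof -
  define Y where "Y w = feature_matrix (\<lambda>i. \<chi> a. w $ (i, a))" for w :: "('l \<times> 'd) rvec"
  have entry: "real_polynomial_function (\<lambda>w. Y w $ i $ p)" for i p
  proof -
    obtain a b where ab: "Rep_upper p = (a, b)" by force
    have lin: "real_polynomial_function (\<lambda>w :: ('l \<times> 'd) rvec. w $ q)" for q
      by (rule real_polynomial_function.intros(1)) (rule bounded_linear_vec_nth)
    show ?thesis
      using lin by (cases "a = b") (auto simp: Y_def feature_matrix_def quad_features_def ab
          intro!: real_polynomial_function_power real_polynomial_function.intros(4))
  qed
  have det: "real_polynomial_function (\<lambda>w. det (transpose (Y w) ** Y w))"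
    by (rule real_polynomial_function_det)
      (auto simp: matrix_matrix_mult_def transpose_def
        intro!: real_polynomial_function_sum real_polynomial_function.intros(4) entry)
  obtain z :: "'l \<Rightarrow> 'd rvec" where z: "\<And>\<nu>. feature_matrix z *v \<nu> = 0 \<Longrightarrow> \<nu> = 0"
    using full_rank_features_exist[OF assms] by blast
  have "Y (\<chi> q. z (fst q) $ snd q) = feature_matrix z" by (simp add: Y_def)
  then have "det (transpose (Y (\<chi> q. z (fst q) $ snd q)) ** Y (\<chi> q. z (fst q) $ snd q)) \<noteq> 0"
    using gram_invertible[OF z] by (simp add: invertible_det_nz)
  then have "AE w in lborel. det (transpose (Y w) ** Y w) \<noteq> 0"
    by (rule AE_polynomial_nonzero[OF det])
  then show ?thesis unfolding Let_def Y_def[symmetric] invertible_det_nz .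
qed

section \<open>Completing the square in the Q-function\<close>

lemma sum_UNIV_Plus:
  "(\<Sum>p\<in>UNIV. F p) = (\<Sum>a\<in>UNIV. F (Inl a)) + (\<Sum>b\<in>UNIV. F (Inr b))"
  for F :: "'a::finite + 'b::finite \<Rightarrow> 'c::comm_monoid_add"
proof -
  have "sum F (UNIV <+> UNIV) = (\<Sum>a\<in>UNIV. F (Inl a)) + (\<Sum>b\<in>UNIV. F (Inr b))"
    by (subst sum.Plus) (simp_all add: o_def del: UNIV_Plus_UNIV)
  then show ?thesis by simp
qed

lemma inner_blk_mult: "x \<bullet> (blk r c L *v y) = (\<Sum>i\<in>UNIV. \<Sum>j\<in>UNIV. x $ i * L $ r i $ c j * y $ j)"
  by (simp add: inner_vec_def matrix_vector_mult_def blk_def sum_distrib_left mult.assoc)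

lemma transpose_blk:
  assumes "transpose L = L"
  shows "transpose (blk r c L) = blk c r L"
proof -
  have "L $ a $ b = L $ b $ a" for a b
    using arg_cong[OF assms, of "\<lambda>T. T $ b $ a"] by (simp add: transpose_def)
  then show ?thesis by (simp add: vec_eq_iff transpose_def blk_def)
qed

lemma stack_quadratic_form:
  assumes sym: "transpose L = L"
  shows "stack x u lam \<bullet> (L *v stack x u lam) =
    x \<bullet> (L11 L *v x) + u \<bullet> (L22 L *v u) + lam \<bullet> (L33 L *v lam)
    + 2 * (u \<bullet> (L21 L *v x)) + 2 * (lam \<bullet> (L31 L *v x)) + 2 * (lam \<bullet> (L32 L *v u))"
proof -
  let ?z = "stack x u lam"
  have "?z \<bullet> (L *v ?z) = (\<Sum>a\<in>UNIV. \<Sum>b\<in>UNIV. ?z $ a * L $ a $ b * ?z $ b)"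
    by (simp add: inner_vec_def matrix_vector_mult_def sum_distrib_left mult.assoc)
  also have "\<dots> = x \<bullet> (blk cx cx L *v x) + x \<bullet> (blk cx cu L *v u) + x \<bullet> (blk cx cl L *v lam)
      + u \<bullet> (blk cu cx L *v x) + u \<bullet> (blk cu cu L *v u) + u \<bullet> (blk cu cl L *v lam)
      + lam \<bullet> (blk cl cx L *v x) + lam \<bullet> (blk cl cu L *v u) + lam \<bullet> (blk cl cl L *v lam)"
    by (simp add: sum_UNIV_Plus inner_blk_mult sum.distrib stack_def cx_def cu_def cl_def)
  also have "x \<bullet> (blk cx cu L *v u) = u \<bullet> (blk cu cx L *v x)"
    using inner_transpose_mult[of x "blk cu cx L" u] by (simp add: transpose_blk[OF sym] inner_commute)
  also have "x \<bullet> (blk cx cl L *v lam) = lam \<bullet> (blk cl cx L *v x)"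
    using inner_transpose_mult[of x "blk cl cx L" lam] by (simp add: transpose_blk[OF sym] inner_commute)
  also have "u \<bullet> (blk cu cl L *v lam) = lam \<bullet> (blk cl cu L *v u)"
    using inner_transpose_mult[of u "blk cl cu L" lam] by (simp add: transpose_blk[OF sym] inner_commute)
  finally show ?thesis by (simp add: L11_def L21_def L22_def L31_def L32_def L33_def)
qed

text \<open>The minimal cost to go from state \<open>x\<close>, when the multiplier \<open>lam\<close> of the terminal constraint is added
  to the cost as a term \<open>2 * (lam \<bullet> x (N + 1))\<close>; \<open>s\<close> holds the parameters for the current time.\<close>

definition value_form :: "'n::finite iterate \<Rightarrow> 'n rvec \<Rightarrow> 'n rvec \<Rightarrow> real" where
  "value_form s lam x = (case s of (P, \<Phi>, G) \<Rightarrow>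
     x \<bullet> (P *v x) + 2 * (lam \<bullet> (\<Phi> *v x)) - lam \<bullet> (G *v lam))"

text \<open>In \<open>u\<close> the form is stationary at the feedback given by the two gains, and its value there is the form of
  the Schur complement of \<open>L22\<close>, whose blocks are what \<open>update\<close> computes.  The block \<open>L33\<close> carries \<open>- G\<close>, so
  the accumulation of \<open>G\<close> in \<open>update\<close> is the Schur complement in the \<open>lam\<close> block.\<close>

lemma complete_the_square:
  assumes sym: "transpose L = L" and inv: "invertible (L22 L)" and L33: "L33 L = - snd (snd s)"
  defines "e x u lam \<equiv> u - (gain_K L *v x + gain_K1 L *v lam)"
  shows "stack x u lam \<bullet> (L *v stack x u lam) =
    value_form (update L s) lam x + e x u lam \<bullet> (L22 L *v e x u lam)"
proof -
  let ?S = "L22 L" and ?Z = "matrix_inv (L22 L)"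
  define p where "p = L21 L *v x"
  define q where "q = transpose (L32 L) *v lam"
  obtain P \<Phi> G where s: "s = (P, \<Phi>, G)" using prod_cases3 by blast
  have symS: "transpose ?S = ?S" unfolding L22_def by (rule transpose_blk[OF sym])
  note symZ = inner_symmetric_mult[OF symmetric_matrix_inv[OF inv symS]]
  have e: "e x u lam = u + ?Z *v (p + q)"
    by (simp add: e_def gain_K_def gain_K1_def p_def q_def uminus_matrix_vector_mult
        matrix_vector_right_distrib matrix_vector_mul_assoc)
  have "e x u lam \<bullet> (?S *v e x u lam) = u \<bullet> (?S *v u) + 2 * (u \<bullet> (p + q)) + (p + q) \<bullet> (?Z *v (p + q))"
    using inner_symmetric_mult[OF symS, of "?Z *v (p + q)" u]
    by (simp add: e matrix_vector_right_distrib[of ?S] matrix_inv_cancel[OF inv] inner_add_left[of u]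
        inner_add_right[of _ "?S *v u"] inner_commute[of "?Z *v (p + q)" "p + q"])
  moreover have "(p + q) \<bullet> (?Z *v (p + q)) = p \<bullet> (?Z *v p) + 2 * (q \<bullet> (?Z *v p)) + q \<bullet> (?Z *v q)"
    using symZ[of p q] by (simp add: matrix_vector_right_distrib inner_add_left inner_add_right)
  moreover have "value_form (update L s) lam x = x \<bullet> (L11 L *v x) - p \<bullet> (?Z *v p)
      + 2 * (lam \<bullet> (L31 L *v x)) - 2 * (q \<bullet> (?Z *v p)) - lam \<bullet> (G *v lam) - q \<bullet> (?Z *v q)"
  proof -
    have "x \<bullet> ((transpose (L21 L) ** ?Z ** L21 L) *v x) = p \<bullet> (?Z *v p)"
      by (simp add: matrix_vector_mul_assoc[symmetric] inner_transpose_mult p_def)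
    moreover have "lam \<bullet> ((L32 L ** ?Z ** L21 L) *v x) = q \<bullet> (?Z *v p)"
      using inner_transpose_mult[of lam "transpose (L32 L)"]
      by (simp add: matrix_vector_mul_assoc[symmetric] p_def q_def)
    moreover have "lam \<bullet> ((L32 L ** ?Z ** transpose (L32 L)) *v lam) = q \<bullet> (?Z *v q)"
      using inner_transpose_mult[of lam "transpose (L32 L)"]
      by (simp add: matrix_vector_mul_assoc[symmetric] q_def)
    ultimately show ?thesis
      by (simp add: value_form_def update_def s matrix_vector_mult_diff_rdistrib
          matrix_vector_mult_add_rdistrib inner_diff_right inner_add_right)
  qed
  moreover have "lam \<bullet> (L32 L *v u) = u \<bullet> q"
    by (simp add: q_def inner_transpose_mult inner_commute)
  moreover have "lam \<bullet> (L33 L *v lam) = - (lam \<bullet> (G *v lam))"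
    by (simp add: L33 s uminus_matrix_vector_mult)
  ultimately show ?thesis
    by (simp add: stack_quadratic_form[OF sym] p_def[symmetric] inner_add_right)
qed

text \<open>The matrix of the quadratic form in \<open>(x, u, lam)\<close> that results from substituting \<open>y = A x + B u\<close> in
  \<open>x' Q x + u' R u + y' P y + 2 y' \<Phi>' lam - lam' G lam\<close>.\<close>

definition bellman_matrix ::
  "real^'n^'n \<Rightarrow> real^'m^'m \<Rightarrow> real^'n^'n \<Rightarrow> real^'m^'n \<Rightarrow> 'n iterate \<Rightarrow>
   ('n::finite, 'm::finite) qmat" where
  "bellman_matrix Q R A B s = (case s of (P, \<Phi>, G) \<Rightarrow> \<chi> a b. (case a of
      Inl i \<Rightarrow> (case b of
          Inl j \<Rightarrow> (Q + transpose A ** P ** A) $ i $ j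
        | Inr (Inl j) \<Rightarrow> (transpose B ** P ** A) $ j $ i
        | Inr (Inr j) \<Rightarrow> (\<Phi> ** A) $ j $ i)
    | Inr (Inl i) \<Rightarrow> (case b of
          Inl j \<Rightarrow> (transpose B ** P ** A) $ i $ j
        | Inr (Inl j) \<Rightarrow> (R + transpose B ** P ** B) $ i $ j
        | Inr (Inr j) \<Rightarrow> (\<Phi> ** B) $ j $ i)
    | Inr (Inr i) \<Rightarrow> (case b of
          Inl j \<Rightarrow> (\<Phi> ** A) $ i $ j
        | Inr (Inl j) \<Rightarrow> (\<Phi> ** B) $ i $ j
        | Inr (Inr j) \<Rightarrow> (- G) $ i $ j)))"

lemma bellman_matrix_blocks:
  "L11 (bellman_matrix Q R A B (P, \<Phi>, G)) = Q + transpose A ** P ** A"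
  "L21 (bellman_matrix Q R A B (P, \<Phi>, G)) = transpose B ** P ** A"
  "L22 (bellman_matrix Q R A B (P, \<Phi>, G)) = R + transpose B ** P ** B"
  "L31 (bellman_matrix Q R A B (P, \<Phi>, G)) = \<Phi> ** A"
  "L32 (bellman_matrix Q R A B (P, \<Phi>, G)) = \<Phi> ** B"
  "L33 (bellman_matrix Q R A B (P, \<Phi>, G)) = - G"
  by (simp_all add: vec_eq_iff bellman_matrix_def L11_def L21_def L22_def L31_def L32_def L33_def
      blk_def cx_def cu_def cl_def)

text \<open>The invariant of the backward recursion: it keeps the learned form symmetric and \<open>L22\<close> positive definite.\<close>

definition admissible :: "'n::finite iterate \<Rightarrow> bool" where
  "admissible s \<longleftrightarrow> (case s of (P, \<Phi>, G) \<Rightarrow> pos_semidef P \<and> pos_semidef G)"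

lemma symmetric_congruence:
  fixes C :: "real^'a^'b" and T :: "real^'b^'b"
  assumes "transpose T = T"
  shows "transpose (transpose C ** T ** C) = transpose C ** T ** C"
  by (simp add: matrix_transpose_mul assms matrix_mul_assoc)

lemma symmetric_add:
  "transpose S = S \<Longrightarrow> transpose T = T \<Longrightarrow> transpose (S + T) = S + T" for S T :: "real^'a^'a"
  by (simp add: transpose_def vec_eq_iff)

lemma symmetric_diff:
  "transpose S = S \<Longrightarrow> transpose T = T \<Longrightarrow> transpose (S - T) = S - T" for S T :: "real^'a^'a"
  by (simp add: transpose_def vec_eq_iff)

lemma inner_congruence: "x \<bullet> ((transpose C ** T ** C') *v y) = (C *v x) \<bullet> (T *v (C' *v y))"
  for C :: "real^'a^'b" and T :: "real^'c^'b" and C' :: "real^'d^'c"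
  by (simp add: matrix_vector_mul_assoc[symmetric] inner_transpose_mult)

lemma pos_def_imp_pos_semidef: "pos_def S \<Longrightarrow> pos_semidef S"
  unfolding pos_def_def pos_semidef_def by (metis inner_zero_left less_eq_real_def)

lemma pos_def_L22_bellman:
  assumes "pos_def R" and "admissible s"
  shows "pos_def (L22 (bellman_matrix Q R A B s))"
proof -
  obtain P \<Phi> G where s: "s = (P, \<Phi>, G)" using prod_cases3 by blast
  have P: "pos_semidef P" using assms(2) by (simp add: admissible_def s)
  have "0 < u \<bullet> (R *v u) + (B *v u) \<bullet> (P *v (B *v u))" if "u \<noteq> 0" for u
    using assms(1) P that by (intro add_pos_nonneg) (auto simp: pos_def_def pos_semidef_def)
  then show ?thesis
    using assms(1) P
    by (simp add: pos_def_def pos_semidef_def s bellman_matrix_blocks symmetric_add symmetric_congruence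
        matrix_vector_mult_add_rdistrib inner_add_right inner_congruence)
qed

lemma bellman_matrix_symmetric:
  assumes "transpose Q = Q" and "transpose R = R" and "admissible s"
  shows "transpose (bellman_matrix Q R A B s) = bellman_matrix Q R A B s"
proof -
  obtain P \<Phi> G where s: "s = (P, \<Phi>, G)" using prod_cases3 by blast
  have sym: "T $ i $ j = T $ j $ i" if "transpose T = T" for T :: "real^'c^'c" and i j
    using arg_cong[OF that, of "\<lambda>T. T $ j $ i"] by (simp add: transpose_def)
  have P: "transpose P = P" "transpose G = G"
    using assms(3) by (auto simp: admissible_def s pos_semidef_def)
  note b = sym[OF symmetric_add[OF assms(1) symmetric_congruence[OF P(1), of A]]]
    sym[OF symmetric_add[OF assms(2) symmetric_congruence[OF P(1), of B]]] sym[OF P(2)]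
  have "bellman_matrix Q R A B s $ c $ a = bellman_matrix Q R A B s $ a $ c" for a c
    unfolding bellman_matrix_def s prod.case vec_lambda_beta
    by (auto split: sum.split simp del: vector_add_component intro: b)
  then show ?thesis by (simp add: transpose_def vec_eq_iff)
qed

lemma bellman_matrix_form:
  assumes "transpose Q = Q" and "transpose R = R" and "admissible (P, \<Phi>, G)"
  shows "stack x u lam \<bullet> (bellman_matrix Q R A B (P, \<Phi>, G) *v stack x u lam) =
    x \<bullet> (Q *v x) + u \<bullet> (R *v u) + value_form (P, \<Phi>, G) lam (A *v x + B *v u)"
proof -
  have "transpose P = P" using assms(3) by (simp add: admissible_def pos_semidef_def)
  then have "(A *v x) \<bullet> (P *v (B *v u)) = (B *v u) \<bullet> (P *v (A *v x))" by (rule inner_symmetric_mult)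
  then show ?thesis
    by (simp add: stack_quadratic_form bellman_matrix_symmetric assms(1-3) bellman_matrix_blocks
        value_form_def matrix_vector_mult_add_rdistrib matrix_vector_right_distrib
        inner_add_left inner_add_right inner_transpose_mult uminus_matrix_vector_mult
        matrix_vector_mul_assoc[symmetric] algebra_simps)
qed

text \<open>The new \<open>P\<close> is nonnegative because its form is the value, at the minimising \<open>u\<close> and for zero
  multiplier, of a sum of nonnegative terms; \<open>G\<close> only ever grows.\<close>

lemma admissible_update:
  fixes B :: "real^'m^'n"
  assumes Q: "pos_semidef Q" and R: "pos_def R" and s: "admissible s"
  shows "admissible (update (bellman_matrix Q R A B s) s)"
proof -
  let ?L = "bellman_matrix Q R A B s"
  let ?Z = "matrix_inv (L22 ?L)"
  obtain P \<Phi> G where S: "s = (P, \<Phi>, G)" using prod_cases3 by blast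
  obtain P' \<Phi>' G' where U: "update ?L s = (P', \<Phi>', G')" using prod_cases3 by blast
  have symQR: "transpose Q = Q" "transpose R = R"
    using Q R by (auto simp: pos_semidef_def pos_def_def)
  note symL = bellman_matrix_symmetric[OF symQR s, of A B]
  note pd = pos_def_L22_bellman[OF R s, of Q A B]
  note inv = pos_def_invertible[OF pd]
  have symZ: "transpose ?Z = ?Z"
    using symmetric_matrix_inv[OF inv] pd by (simp add: pos_def_def)
  have P': "P' = L11 ?L - transpose (L21 ?L) ** ?Z ** L21 ?L"
    and G': "G' = G + L32 ?L ** ?Z ** transpose (L32 ?L)"
    using U by (simp_all add: update_def S)
  have "0 \<le> x \<bullet> (P' *v x)" for x
  proof -
    let ?u = "gain_K ?L *v x"
    let ?y = "A *v x + B *v ?u"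
    have "x \<bullet> (P' *v x) = value_form (update ?L s) 0 x" by (simp add: U value_form_def)
    also have "\<dots> = stack x ?u 0 \<bullet> (?L *v stack x ?u 0)"
      by (subst complete_the_square[OF symL inv, of s]) (simp_all add: S bellman_matrix_blocks)
    also have "\<dots> = x \<bullet> (Q *v x) + ?u \<bullet> (R *v ?u) + ?y \<bullet> (P *v ?y)"
      using bellman_matrix_form[OF symQR s[unfolded S], of x ?u 0 A B] by (simp add: S value_form_def)
    also have "\<dots> \<ge> 0"
      using Q s pos_def_imp_pos_semidef[OF R]
      by (auto simp: pos_semidef_def admissible_def S intro!: add_nonneg_nonneg)
    finally show ?thesis .
  qed
  moreover have "transpose P' = P'"
    unfolding P' using symL symZ
    by (intro symmetric_diff symmetric_congruence) (simp_all add: L11_def transpose_blk)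
  moreover have "0 \<le> x \<bullet> (G' *v x)" for x
    using pos_def_inverse_form(1)[OF pd, of "transpose (L32 ?L) *v x"] s
      inner_congruence[of x "transpose (L32 ?L)" ?Z "transpose (L32 ?L)" x]
    by (simp add: G' matrix_vector_mult_add_rdistrib inner_add_right admissible_def S pos_semidef_def)
  moreover have "transpose G' = G'"
    unfolding G' using s symmetric_congruence[OF symZ, of "transpose (L32 ?L)"]
    by (intro symmetric_add) (simp_all add: admissible_def S pos_semidef_def)
  ultimately show ?thesis unfolding U by (simp add: admissible_def pos_semidef_def)
qed

section \<open>The learned matrix\<close>

text \<open>The observations are noise-free values of the quadratic form of \<open>bellman_matrix\<close>, so the regression
  has zero residual at its half-vectorised matrix.\<close>

lemma learned_matrix_eq_bellman_matrix:
  assumes sym: "transpose Q = Q" "transpose R = R" and s: "admissible s"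
    and inv: "invertible (transpose (regressor D) ** regressor D)"
    and data: "\<And>i. smp_next (D i) = A *v smp_x (D i) + B *v smp_u (D i)"
  shows "learned_matrix Q R s D = bellman_matrix Q R A B s"
proof -
  let ?L = "bellman_matrix Q R A B s"
  obtain P \<Phi> G where S: "s = (P, \<Phi>, G)" using prod_cases3 by blast
  note symL = bellman_matrix_symmetric[OF sym s, of A B]
  have "target Q R s D = regressor D *v half_vec ?L"
  proof -
    have "target Q R s D $ i = (regressor D *v half_vec ?L) $ i" for i
      by (simp add: regressor_def matrix_vector_mul_component quad_features_inner
          sym_matrix_half_vec[OF symL])
        (simp add: target_def S data Let_def value_form_def bellman_matrix_form[OF sym s[unfolded S]]
          inner_transpose_mult inner_commute)
    then show ?thesis by (simp add: vec_eq_iff)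
  qed
  then show ?thesis
    by (simp add: learned_matrix_def ls_formula_exact[OF inv] sym_matrix_half_vec[OF symL])
qed

section \<open>Optimality of the feedback\<close>

text \<open>The backward sweep as seen by the model: identification has to be known only for admissible
  iterates, because regression recovers the matrix from symmetric parameters; admissibility is then derived
  along the sweep.\<close>

locale backward_recursion =
  fixes A :: "nat \<Rightarrow> real^'n^'n" and B :: "nat \<Rightarrow> real^'m^'n"
    and Q H :: "real^'n^'n" and R :: "real^'m^'m" and N :: nat
    and s :: "nat \<Rightarrow> 'n::finite iterate" and L :: "nat \<Rightarrow> ('n, 'm::finite) qmat"
  assumes Q: "pos_semidef Q" and H: "pos_semidef H" and R: "pos_def R"
    and final: "s (Suc N) = (H, mat 1, 0)"
    and L: "k \<le> N \<Longrightarrow> admissible (s (Suc k)) \<Longrightarrow> L k = bellman_matrix Q R (A k) (B k) (s (Suc k))"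
    and step: "k \<le> N \<Longrightarrow> s k = update (L k) (s (Suc k))"
begin

lemma admissible: "k \<le> Suc N \<Longrightarrow> admissible (s k)"
proof (induction k rule: inc_induct)
  case base
  show ?case using H by (simp add: final admissible_def pos_semidef_def)
      (simp add: transpose_def vec_eq_iff)
next
  case (step k)
  then show ?case
    using admissible_update[OF Q R step.IH] L[of k]
      backward_recursion.step[OF backward_recursion_axioms, of k] by simp
qed

lemma symmetric_weights: "transpose Q = Q" "transpose R = R"
  using Q R by (auto simp: pos_semidef_def pos_def_def)

lemma L_eq: "k \<le> N \<Longrightarrow> L k = bellman_matrix Q R (A k) (B k) (s (Suc k))"
  using L admissible by simp

lemma L22_pos_def: "k \<le> N \<Longrightarrow> pos_def (L22 (L k))"
  using pos_def_L22_bellman[OF R admissible] by (simp add: L_eq)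

lemmas L22_invertible = pos_def_invertible[OF L22_pos_def]

definition \<Phi> :: "nat \<Rightarrow> real^'n^'n" where "\<Phi> k = fst (snd (s k))"
definition G :: "nat \<Rightarrow> real^'n^'n" where "G k = snd (snd (s k))"

lemma blocks:
  assumes "k \<le> N"
  shows "L31 (L k) = \<Phi> (Suc k) ** A k" "L32 (L k) = \<Phi> (Suc k) ** B k" "L33 (L k) = - G (Suc k)"
  using bellman_matrix_blocks[of Q R "A k" "B k" "fst (s (Suc k))" "fst (snd (s (Suc k)))" "snd (snd (s (Suc k)))"]
  by (simp_all add: L_eq assms \<Phi>_def G_def)

lemma recursion:
  assumes "k \<le> N"
  shows "\<Phi> k = L31 (L k) - L32 (L k) ** matrix_inv (L22 (L k)) ** L21 (L k)"
    and "G k = G (Suc k) + L32 (L k) ** matrix_inv (L22 (L k)) ** transpose (L32 (L k))"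
  by (simp_all add: \<Phi>_def G_def step[OF assms] update_def split: prod.split)

lemma \<Phi>_G_final: "\<Phi> (Suc N) = mat 1" "G (Suc N) = 0"
  by (simp_all add: \<Phi>_def G_def final)

definition policy :: "real^'n \<Rightarrow> nat \<Rightarrow> real^'n \<Rightarrow> real^'m" where
  "policy lam k x = gain_K (L k) *v x + gain_K1 (L k) *v lam"

lemma stage_identity:
  assumes k: "k \<le> N"
  shows "x \<bullet> (Q *v x) + u \<bullet> (R *v u) + value_form (s (Suc k)) lam (A k *v x + B k *v u) =
    value_form (s k) lam x + (u - policy lam k x) \<bullet> (L22 (L k) *v (u - policy lam k x))"
proof -
  obtain P' \<Phi>' G' where S: "s (Suc k) = (P', \<Phi>', G')" using prod_cases3 by blast
  have adm: "admissible (s (Suc k))" using k by (simp add: admissible)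
  have sym: "transpose (L k) = L k"
    unfolding L_eq[OF k] by (rule bellman_matrix_symmetric[OF symmetric_weights adm])
  have "stack x u lam \<bullet> (L k *v stack x u lam) =
      x \<bullet> (Q *v x) + u \<bullet> (R *v u) + value_form (s (Suc k)) lam (A k *v x + B k *v u)"
    using bellman_matrix_form[OF symmetric_weights adm[unfolded S]] by (simp add: L_eq[OF k] S)
  moreover have "stack x u lam \<bullet> (L k *v stack x u lam) =
    value_form (s k) lam x + (u - policy lam k x) \<bullet> (L22 (L k) *v (u - policy lam k x))"
    unfolding policy_def step[OF k]
    by (rule complete_the_square[OF sym L22_invertible[OF k]]) (simp add: blocks[OF k] G_def)
  ultimately show ?thesis by simp
qed

text \<open>The stage identities telescope, and the final value is the terminal cost plus the multiplier term.\<close>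

lemma cost_identity:
  defines "e x0 u lam k \<equiv> u k - policy lam k (trajectory A B x0 u k)"
  shows "cost A B Q R H N x0 u + 2 * (lam \<bullet> trajectory A B x0 u (Suc N)) =
    value_form (s 0) lam x0 + (\<Sum>k\<le>N. e x0 u lam k \<bullet> (L22 (L k) *v e x0 u lam k))"
proof -
  define x where "x = trajectory A B x0 u"
  let ?e = "e x0 u lam"
  have "(\<Sum>k<j. x k \<bullet> (Q *v x k) + u k \<bullet> (R *v u k)) + value_form (s j) lam (x j) =
      value_form (s 0) lam x0 + (\<Sum>k<j. ?e k \<bullet> (L22 (L k) *v ?e k))" if "j \<le> Suc N" for j
    using that
  proof (induction j)
    case 0
    show ?case by (simp add: x_def)
  next
    case (Suc j)
    then show ?case
      using stage_identity[of j "x j" "u j" lam] by (simp add: x_def e_def)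
  qed
  from this[of "Suc N"] have "(\<Sum>k\<le>N. x k \<bullet> (Q *v x k) + u k \<bullet> (R *v u k))
      + (x (Suc N) \<bullet> (H *v x (Suc N)) + 2 * (lam \<bullet> x (Suc N))) =
      value_form (s 0) lam x0 + (\<Sum>k\<le>N. ?e k \<bullet> (L22 (L k) *v ?e k))"
    by (simp only: lessThan_Suc_atMost) (simp add: final value_form_def)
  then show ?thesis by (simp add: cost_def Let_def x_def atLeast0AtMost)
qed

text \<open>The vector \<open>\<Phi> k x k - G k lam\<close> is invariant along the closed loop, because \<open>\<Phi>\<close> propagates
  the state feedback and \<open>G\<close> collects the effect of the constant multiplier.\<close>

lemma closed_loop_terminal:
  "closed_loop A B x0 (policy lam) (Suc N) = \<Phi> 0 *v x0 - G 0 *v lam"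
proof -
  let ?x = "closed_loop A B x0 (policy lam)"
  have "\<Phi> k *v ?x k - G k *v lam = \<Phi> 0 *v x0 - G 0 *v lam" if "k \<le> Suc N" for k
    using that
  proof (induction k)
    case (Suc k)
    then have k: "k \<le> N" by simp
    have "\<Phi> (Suc k) *v ?x (Suc k) = L31 (L k) *v ?x k + L32 (L k) *v policy lam k (?x k)"
      by (simp add: blocks[OF k] matrix_vector_right_distrib matrix_vector_mul_assoc)
    also have "\<dots> = \<Phi> k *v ?x k + (G (Suc k) *v lam - G k *v lam)"
      by (simp add: recursion[OF k] policy_def gain_K_def gain_K1_def uminus_matrix_vector_mult
          matrix_vector_mult_uminus matrix_vector_mult_diff_rdistrib matrix_vector_mult_add_rdistrib
          matrix_vector_mult_diff_distrib matrix_vector_mul_assoc matrix_mul_assoc)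
    finally show ?case using Suc by simp
  qed simp
  from this[of "Suc N"] show ?thesis by (simp add: \<Phi>_G_final)
qed

text \<open>Since \<open>G 0\<close> is a sum of positive semidefinite terms, all of them vanish at \<open>w\<close>; definiteness of
  \<open>L22\<close> then gives \<open>L32' w = 0\<close> at every time, so the input has no effect on
  \<open>w \<bullet> (\<Phi> k x k)\<close>, which is therefore constant.\<close>

lemma unreachable_directions:
  assumes w: "w \<bullet> (G 0 *v w) = 0"
  shows "w \<bullet> trajectory A B x0 u (Suc N) = w \<bullet> (\<Phi> 0 *v x0)"
proof -
  let ?x = "trajectory A B x0 u"
  have "w \<bullet> (G k *v w) = 0 \<and> w \<bullet> (\<Phi> k *v ?x k) = w \<bullet> (\<Phi> 0 *v x0)" if "k \<le> Suc N" for k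
    using that
  proof (induction k)
    case 0
    show ?case using w by simp
  next
    case (Suc k)
    then have k: "k \<le> N" by simp
    let ?q = "transpose (L32 (L k)) *v w" and ?Z = "matrix_inv (L22 (L k))"
    have q: "w \<bullet> (L32 (L k) *v v) = ?q \<bullet> v" for v
      using inner_transpose_mult[of w "transpose (L32 (L k))" v] by simp
    have "0 \<le> w \<bullet> (G (Suc k) *v w)"
      using admissible[of "Suc k"] k
      by (auto simp: admissible_def pos_semidef_def G_def split: prod.splits)
    moreover have "0 \<le> ?q \<bullet> (?Z *v ?q)"
      by (rule pos_def_inverse_form(1)[OF L22_pos_def[OF k]])
    moreover have "w \<bullet> (G k *v w) = w \<bullet> (G (Suc k) *v w) + ?q \<bullet> (?Z *v ?q)"
      by (simp add: recursion[OF k] matrix_vector_mult_add_rdistrib inner_add_right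
          matrix_vector_mul_assoc[symmetric] q)
    ultimately have zero: "w \<bullet> (G (Suc k) *v w) = 0" "?q \<bullet> (?Z *v ?q) = 0"
      using Suc by auto
    have "?q = 0" using pos_def_inverse_form(2)[OF L22_pos_def[OF k] zero(2)] .
    then have L32: "w \<bullet> (L32 (L k) *v v) = 0" for v by (simp add: q)
    have "w \<bullet> (\<Phi> (Suc k) *v ?x (Suc k)) = w \<bullet> (L31 (L k) *v ?x k) + w \<bullet> (L32 (L k) *v u k)"
      by (simp add: blocks[OF k] matrix_vector_right_distrib inner_add_right matrix_vector_mul_assoc)
    also have "\<dots> = w \<bullet> (\<Phi> k *v ?x k)"
      using L32 by (simp add: recursion[OF k] matrix_vector_mult_diff_rdistrib inner_diff_right
          matrix_vector_mul_assoc[symmetric])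
    finally show ?case using Suc zero(1) by simp
  qed
  from this[of "Suc N"] show ?thesis by (simp add: \<Phi>_G_final)
qed

text \<open>At time 0 the blocks \<open>- L33\<close> and \<open>L31\<close> still belong to time 1; with their Schur corrections they
  become \<open>G 0\<close> and \<open>\<Phi> 0\<close>, the matrices of the terminal state.\<close>

lemma multiplier_exists:
  assumes "reachable A B N x0 \<xi>"
  shows "G 0 *v lam_star (L 0) x0 \<xi> = \<Phi> 0 *v x0 - \<xi>"
proof -
  have lam: "lam_star (L 0) x0 \<xi> = pseudo_inv (G 0) *v (\<Phi> 0 *v x0 - \<xi>)"
    by (simp add: lam_star_def recursion blocks)
  obtain u where u: "trajectory A B x0 u (Suc N) = \<xi>"
    using assms by (auto simp: reachable_def)
  have "transpose (G 0) = G 0"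
    using admissible[of 0] by (auto simp: admissible_def pos_semidef_def G_def split: prod.splits)
  then show ?thesis
    unfolding lam
  proof (rule pseudo_inv_solves)
    fix w assume "G 0 *v w = 0"
    then show "w \<bullet> (\<Phi> 0 *v x0 - \<xi>) = 0"
      using unreachable_directions[of w x0 u] u by (simp add: inner_diff_right)
  qed
qed

lemma trajectory_applied_control:
  "trajectory A B x0 (applied_control A B x0 \<pi>) k = closed_loop A B x0 \<pi> k"
  by (induction k) (simp_all add: applied_control_def)

text \<open>With the terminal state fixed, the multiplier term in \<open>cost_identity\<close> is a constant; what depends on
  the control is a sum of squares that vanishes exactly for the feedback.\<close>

theorem optimal_policy:
  assumes reach: "reachable A B N x0 \<xi>"
  defines "u \<equiv> applied_control A B x0 (policy (lam_star (L 0) x0 \<xi>))"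
  shows "optimal_control A B Q R H N x0 \<xi> u"
    and "\<And>v k. optimal_control A B Q R H N x0 \<xi> v \<Longrightarrow> k \<le> N \<Longrightarrow> v k = u k"
proof -
  define lam where "lam = lam_star (L 0) x0 \<xi>"
  define e where "e v k = v k - policy lam k (trajectory A B x0 v k)" for v k
  define c where "c = value_form (s 0) lam x0 - 2 * (lam \<bullet> \<xi>)"
  have cost: "cost A B Q R H N x0 v = c + (\<Sum>k\<le>N. e v k \<bullet> (L22 (L k) *v e v k))"
    if "trajectory A B x0 v (N + 1) = \<xi>" for v
    using cost_identity[of x0 v lam] that by (simp add: c_def e_def)
  have nonneg: "0 \<le> e v k \<bullet> (L22 (L k) *v e v k)" if "k \<le> N" for v k
    using pos_def_imp_pos_semidef[OF L22_pos_def[OF that]] by (simp add: pos_semidef_def)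
  have eu: "e u k = 0" for k
    by (simp add: e_def u_def trajectory_applied_control) (simp add: applied_control_def lam_def)
  have feasible: "trajectory A B x0 u (N + 1) = \<xi>"
    using closed_loop_terminal[of x0 lam] multiplier_exists[OF reach]
    by (simp only: u_def trajectory_applied_control lam_def Suc_eq_plus1[symmetric]) simp
  have cost_u: "cost A B Q R H N x0 u = c" using cost[OF feasible] eu by simp
  show "optimal_control A B Q R H N x0 \<xi> u"
    unfolding optimal_control_def is_arg_min_linorder
    using feasible cost cost_u nonneg by (auto intro!: sum_nonneg)
  fix v k assume v: "optimal_control A B Q R H N x0 \<xi> v" and "k \<le> N"
  have fv: "trajectory A B x0 v (N + 1) = \<xi>" and "cost A B Q R H N x0 v \<le> c"
    using v feasible cost_u by (auto simp: optimal_control_def is_arg_min_linorder)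
  then have "(\<Sum>k\<le>N. e v k \<bullet> (L22 (L k) *v e v k)) \<le> 0" using cost[OF fv] by simp
  moreover have "0 \<le> (\<Sum>k\<le>N. e v k \<bullet> (L22 (L k) *v e v k))"
    using nonneg by (intro sum_nonneg) auto
  ultimately have "(\<Sum>k\<le>N. e v k \<bullet> (L22 (L k) *v e v k)) = 0" by linarith
  then have "e v k \<bullet> (L22 (L k) *v e v k) = 0" if "k \<le> N" for k
    using that nonneg by (subst (asm) sum_nonneg_eq_0_iff) auto
  then have ev: "e v k = 0" if "k \<le> N" for k
    using that L22_pos_def[OF that] unfolding pos_def_def by (metis less_irrefl)
  have same: "trajectory A B x0 v j = trajectory A B x0 u j" if "j \<le> N" for j
    using that
  proof (induction j)
    case (Suc j)
    then show ?case using ev[of j] eu[of j] by (simp add: e_def)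
  qed simp
  show "v k = u k" using ev[OF \<open>k \<le> N\<close>] eu[of k] same[OF \<open>k \<le> N\<close>] by (simp add: e_def)
qed

end

section \<open>Optimality of the learned controller\<close>

theorem theorem2:
  fixes A :: "nat \<Rightarrow> ('n::{finite, linorder}, 'n) rmat"
    and B :: "nat \<Rightarrow> ('n, 'm::{finite, linorder}) rmat"
    and Q H :: "('n, 'n) rmat" and R :: "('m, 'm) rmat"
    and N :: nat and x0 \<xi> :: "'n rvec"
    and M :: "'w measure"
    and X :: "nat \<Rightarrow> 'l::finite \<Rightarrow> 'w \<Rightarrow> 'n rvec"
    and U :: "nat \<Rightarrow> 'l \<Rightarrow> 'w \<Rightarrow> 'm rvec"
    and Lam :: "nat \<Rightarrow> 'l \<Rightarrow> 'w \<Rightarrow> 'n rvec"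
    and mean :: "nat \<Rightarrow> ('l \<times> ('n, 'm) coord) rvec"
    and cov :: "nat \<Rightarrow> ('l \<times> ('n, 'm) coord, 'l \<times> ('n, 'm) coord) rmat"
  defines "D \<equiv> \<lambda>\<omega>. measured_data A B (\<lambda>k i. X k i \<omega>) (\<lambda>k i. U k i \<omega>) (\<lambda>k i. Lam k i \<omega>)"
  assumes Q: "pos_semidef Q" and H: "pos_semidef H" and R: "pos_def R"
    and reach: "reachable A B N x0 \<xi>"
    and prob: "prob_space M"
    and enough: "CARD('l) \<ge> (2 * CARD('n) + CARD('m)) * (2 * CARD('n) + CARD('m) + 1) div 2"
    and gauss: "\<And>k. k \<le> N \<Longrightarrow>
      gaussian_vector M (\<lambda>\<omega>. stack_samples (\<lambda>i. X k i \<omega>) (\<lambda>i. U k i \<omega>) (\<lambda>i. Lam k i \<omega>))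
        (mean k) (cov k)"
  shows "AE \<omega> in M.
    (\<forall>k\<le>N. let Y = regressor (D \<omega> k); g = q_target Q R H N (D \<omega>) k in
       invertible (transpose Y ** Y) \<and> ls_solutions Y g = {ls_formula Y g}) \<and>
    (\<forall>k\<le>N. invertible (L22 (q_matrix Q R H N (D \<omega>) k))) \<and>
    (let u = applied_control A B x0 (q_policy Q R H N (D \<omega>) x0 \<xi>) in
       optimal_control A B Q R H N x0 \<xi> u \<and>
       (\<forall>v. optimal_control A B Q R H N x0 \<xi> v \<longrightarrow> (\<forall>k\<le>N. v k = u k)))"
proof -
  have "CARD(('n, 'm) coord) = 2 * CARD('n) + CARD('m)" by simp
  then have card: "CARD(('n, 'm) coord upper) \<le> CARD('l)"
    using enough by (simp only: card_upper)
  have "AE \<omega> in M. \<forall>k\<in>{..N}. invertible (transpose (regressor (D \<omega> k)) ** regressor (D \<omega> k))"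
  proof (rule AE_finite_allI)
    fix k assume "k \<in> {..N}"
    then have k: "k \<le> N" by simp
    have "regressor (D \<omega> k) = feature_matrix (\<lambda>i. \<chi> a.
        stack_samples (\<lambda>i. X k i \<omega>) (\<lambda>i. U k i \<omega>) (\<lambda>i. Lam k i \<omega>) $ (i, a))" for \<omega>
      by (simp add: D_def measured_data_def regressor_def feature_matrix_def stack_samples_def)
    then show "AE \<omega> in M. invertible (transpose (regressor (D \<omega> k)) ** regressor (D \<omega> k))"
      using AE_gaussian_vector[OF gauss[OF k] AE_feature_gram_invertible[OF card]]
      by (simp add: Let_def)
  qed simp
  then show ?thesis
  proof eventually_elim
    case (elim \<omega>)
    then have inv: "invertible (transpose (regressor (D \<omega> k)) ** regressor (D \<omega> k))" if "k \<le> N" for k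
      using that by simp
    have sym: "transpose Q = Q" "transpose R = R" using Q R by (auto simp: pos_semidef_def pos_def_def)
    interpret backward_recursion A B Q H R N "iterate_at Q R H N (D \<omega>)" "q_matrix Q R H N (D \<omega>)"
    proof
      fix k assume k: "k \<le> N"
      show "iterate_at Q R H N (D \<omega>) k =
          update (q_matrix Q R H N (D \<omega>) k) (iterate_at Q R H N (D \<omega>) (Suc k))"
        using k by (simp add: iterate_at_def q_matrix_def Suc_diff_le)
      assume "admissible (iterate_at Q R H N (D \<omega>) (Suc k))"
      then show "q_matrix Q R H N (D \<omega>) k =
          bellman_matrix Q R (A k) (B k) (iterate_at Q R H N (D \<omega>) (Suc k))"
        unfolding q_matrix_def
        by (subst learned_matrix_eq_bellman_matrix[OF sym _ inv[OF k]])
          (simp_all add: D_def measured_data_def)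
    qed (use Q H R in \<open>simp_all add: iterate_at_def\<close>)
    have "q_policy Q R H N (D \<omega>) x0 \<xi> = policy (lam_star (q_matrix Q R H N (D \<omega>) 0) x0 \<xi>)"
      by (simp add: fun_eq_iff q_policy_def policy_def)
    then show ?case
      using inv ls_solutions_eq L22_invertible optimal_policy[OF reach] by (auto simp: Let_def)
  qed
qed

end
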